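(* Let $\mathrm{Y}(\mathfrak{q}_1)$ be the Yangian of the queer Lie superalgebra $\mathfrak{q}_1$. Let $C(u)=t_{1,1}(u)\tilde t_{1,1}(-u)$ and $D(u)=t_{1,-1}(u)\tilde t_{1,-1}(u)$, let $Q(u)=(1+H(u))(1-H(u))^{-1}$ with $H(u)=\sum_{i\ge 0}Z_{2i}u^{-2i-1}$, and let $\delta(u)=\sqrt{1+4u^2}$ and $\rho(u)=\frac{\delta(u)-1}{2}$ (all as defined in the context). Then the following relations hold in $\mathrm{Y}(\mathfrak{q}_1)[[u^{-1}]]$: $$Q(\rho(u))=C(u)-(\delta(u)+2u)\,D(u),$$ $$[Q(\rho(u)+1)]^{-1}=C(u)+(\delta(u)-2u)\,D(u).$$
   Context: All algebras are over $\mathbb{C}$. Indices $i,j,k,l$ run over $\{1,-1\}$; $\bar i=0$ if $i>0$ and $\bar i=1$ if $i<0$. The Yangian $\mathrm{Y}(\mathfrak{q}_1)$ is the unital associative superalgebra with generators $t_{i,j}^{(r)}$ ($r=1,2,\dots$; $i,j=\pm1$) of $\mathbb{Z}_2$-degree $\bar i+\bar j$. With $t_{i,j}(u)=\delta_{i,j}+t_{i,j}^{(1)}u^{-1}+t_{i,j}^{(2)}u^{-2}+\cdots$, the defining relations are $$[t_{i,j}(u),t_{k,l}(v)](-1)^{\bar i\bar k+\bar i\bar l+\bar k\bar l}=\frac{t_{k,j}(u)t_{i,l}(v)-t_{k,j}(v)t_{i,l}(u)}{u-v}-\frac{t_{-k,j}(u)t_{-i,l}(v)-t_{k,-j}(v)t_{i,-l}(u)}{u+v}(-1)^{\bar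 k+\bar l}$$ and $t_{i,j}(-u)=t_{-i,-j}(u)$, where $[\cdot,\cdot]$ is the supercommutator. Let $E_{i,j}\in\mathrm{End}\,\mathbb{C}^{1|1}$ be the matrix units, of degree $\bar i+\bar j$. The element $T(u)=\sum_{i,j}E_{i,j}\otimes t_{i,j}(u)$ of the super tensor product $\mathrm{End}\,\mathbb{C}^{1|1}\otimes\mathrm{Y}(\mathfrak{q}_1)[[u^{-1}]]$ is invertible (multiplication $(a\otimes b)(c\otimes d)=(-1)^{\deg b\deg c}ac\otimes bd$), and $\tilde t_{i,j}(u)$ is defined by $T(u)^{-1}=\sum_{i,j}E_{i,j}\otimes\tilde t_{i,j}(u)$. For $i\ge0$ put $\eta_i=(-\tfrac12)^i(\mathrm{ad}\,t_{1,1}^{(2)})^i(t_{1,-1}^{(1)})$ and $Z_{2i}=\tfrac12[\eta_0,\eta_{2i}]$ (supercommutator). The elements $Z_{2i}$ and all coefficients of $C(u)$ are known to be central in $\mathrm{Y}(\mathfrak{q}_1)$. The series $\delta(u)$ is the formal Laurent series in $u^{-1}$ $$\delta(u)=2u\sqrt{1+\tfrac{1}{4u^2}}=2u\left(1+\tfrac18u^{-2}-\tfrac1{128}u^{-4}+\cdots\right),$$ so that $\delta(u)^2=1+4u^2$. Since $\rho(u)=u-\tfrac12+\cdots$, the series $Q(\rho(u))$ and $Q(\rho(u)+1)$ are obtained by substituting $\rho(u)$, respectively $\rho(u)+1$, for $u$ in $Q(u)$ and expanding in powers of $u^{-1}$. *)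

theory Defs
  imports
    Complex_Main
    "HOL-Library.Poly_Mapping"
    "HOL-Library.Z2"
    "HOL-Computational_Algebra.Formal_Laurent_Series"
begin

unbundle fps_syntax

section \<open>Indices and signs\<close>

datatype idx = Pos | Neg

instantiation idx :: "{one, uminus}"
begin
definition one_idx :: idx where "1 = Pos"
definition uminus_idx :: "idx \<Rightarrow> idx" where "- i = (case i of Pos \<Rightarrow> Neg | Neg \<Rightarrow> Pos)"
instance ..
end

lemma UNIV_idx: "UNIV = {Pos, Neg}"
  by (auto intro: idx.exhaust)

instance idx :: finite
  by standard (simp add: UNIV_idx)

lemma uminus_idx_simps [simp]: "- Pos = Neg" "- Neg = Pos"
  by (simp_all add: uminus_idx_def)

text \<open>The type \<^typ>\<open>bit\<close> is the field of two elements; it serves as the grading group.\<close>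

definition bar :: "idx \<Rightarrow> bit" where
  "bar i = (case i of Pos \<Rightarrow> 0 | Neg \<Rightarrow> 1)"

lemma bar_simps [simp]: "bar Pos = 0" "bar Neg = 1"
  by (simp_all add: bar_def)

definition ksign :: "bit \<Rightarrow> 'a::ring_1" where
  "ksign p = (if p = 0 then 1 else - 1)"

lemma ksign_mult: "ksign p * x = (if p = 0 then x else - x)"
  by (simp add: ksign_def)

lemma ksign_add: "ksign (p + q) = ksign p * ksign q"
  by (cases p; cases q) (simp_all add: ksign_def)

lemma bit_add_self: "(p::bit) + p = 0"
  by (cases p) simp_all

section \<open>The free superalgebra on the generators\<close>

text \<open>The letter \<open>(i, j, n)\<close> stands for the generator \<open>t\<^sub>i\<^sub>j\<close> with superscript
  \<open>n + 1\<close>, as the superscripts start from 1.\<close>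

type_synonym letter = "idx \<times> idx \<times> nat"

datatype word = Word (letters: "letter list")

instantiation word :: monoid_add
begin
definition zero_word :: word where "0 = Word []"
definition plus_word :: "word \<Rightarrow> word \<Rightarrow> word" where "v + w = Word (letters v @ letters w)"
instance by standard (simp_all add: zero_word_def plus_word_def)
end

definition wdeg :: "word \<Rightarrow> bit" where
  "wdeg w = (\<Sum>(i, j, n)\<leftarrow>letters w. bar i + bar j)"

lemma wdeg_0 [simp]: "wdeg 0 = 0"
  by (simp add: wdeg_def zero_word_def)

lemma wdeg_add [simp]: "wdeg (v + w) = wdeg v + wdeg w"
  by (simp add: wdeg_def plus_word_def)

lemma word_add_eq_0_iff [simp]: "(v + w = (0::word)) \<longleftrightarrow> v = 0 \<and> w = 0"
  by (cases v; cases w) (simp add: zero_word_def plus_word_def)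

type_synonym free = "word \<Rightarrow>\<^sub>0 complex"

lift_definition fcomp :: "bit \<Rightarrow> free \<Rightarrow> free" is
  "\<lambda>p f w. if wdeg w = p then f w else 0"
  by (rule finite_subset[rotated]) auto

definition gfree :: "idx \<Rightarrow> idx \<Rightarrow> nat \<Rightarrow> free" where
  "gfree i j r = (if r = 0 then of_bool (i = j) else Poly_Mapping.single (Word [(i, j, r - 1)]) 1)"

definition gfree_series :: "idx \<Rightarrow> idx \<Rightarrow> free fps" where
  "gfree_series i j = Abs_fps (gfree i j)"

text \<open>All power series are in the variable \<open>u\<^sup>-\<^sup>1\<close>: the \<open>n\<close>-th coefficient belongs to
  the \<open>n\<close>-th power of \<open>u\<^sup>-\<^sup>1\<close>. Accordingly, \<^const>\<open>fls_X_inv\<close> stands for \<open>u\<close>, and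
  substituting \<open>-u\<close> for \<open>u\<close> is the following operation.\<close>

definition subst_neg :: "'a::ring_1 fps \<Rightarrow> 'a fps" where
  "subst_neg f = f oo (- fps_X)"

lemma subst_neg_nth: "subst_neg f $ n = f $ n * (- 1) ^ n"
proof -
  have "((- fps_X :: 'a fps) ^ i) $ n = (if i = n then (- 1) ^ n else 0)" for i
  proof -
    have "(- fps_X :: 'a fps) ^ i = (if even i then fps_X ^ i else - (fps_X ^ i))"
      by simp
    thus ?thesis
      by (auto simp: fps_X_power_iff)
  qed
  hence "subst_neg f $ n = (\<Sum>i = 0..n. if i = n then f $ i * (- 1) ^ n else 0)"
    unfolding subst_neg_def fps_compose_nth by (intro sum.cong) simp_all
  thus ?thesis
    by simp
qed

text \<open>Series in the two variables \<open>u\<close>, \<open>v\<close> are Laurent series in \<open>v\<^sup>-\<^sup>1\<close> whose coefficients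
  are Laurent series in \<open>u\<^sup>-\<^sup>1\<close>.\<close>

definition in_u :: "'a::ring_1 fps \<Rightarrow> 'a fls fls" where
  "in_u f = fls_const (fps_to_fls f)"

definition in_v :: "'a::ring_1 fps \<Rightarrow> 'a fls fls" where
  "in_v f = fps_to_fls (Abs_fps (\<lambda>n. fls_const (f $ n)))"

definition var_u :: "'a::ring_1 fls fls" where "var_u = fls_const fls_X_inv"

definition var_v :: "'a::ring_1 fls fls" where "var_v = fls_X_inv"

text \<open>Difference of the two sides of the first defining relation, both multiplied by
  \<open>u\<^sup>2 - v\<^sup>2\<close>. The fraction over \<open>u + v\<close> is a series in \<open>u\<^sup>-\<^sup>1\<close>, \<open>v\<^sup>-\<^sup>1\<close> only modulo the
  second relation, so the denominators have to be cleared in the free algebra.\<close>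

definition relator1 :: "idx \<Rightarrow> idx \<Rightarrow> idx \<Rightarrow> idx \<Rightarrow> free fls fls" where
  "relator1 i j k l =
    (let tu = (\<lambda>i j. in_u (gfree_series i j));
         tv = (\<lambda>i j. in_v (gfree_series i j));
         u = var_u; v = var_v;
         bracket = tu i j * tv k l - ksign ((bar i + bar j) * (bar k + bar l)) * (tv k l * tu i j)
     in (u ^ 2 - v ^ 2) * (ksign (bar i * bar k + bar i * bar l + bar k * bar l) * bracket)
        - ((u + v) * (tu k j * tv i l - tv k j * tu i l)
           - ksign (bar k + bar l) * ((u - v) * (tu (- k) j * tv (- i) l - tv k (- j) * tu i (- l)))))"

definition relator2 :: "idx \<Rightarrow> idx \<Rightarrow> free fps" where
  "relator2 i j = subst_neg (gfree_series i j) - gfree_series (- i) (- j)"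

text \<open>The two-sided ideal generated by all coefficients of the relators.
  Scalar multiplication is a special case of multiplication by ring elements.\<close>

inductive_set rel_ideal :: "free set" where
  zero: "0 \<in> rel_ideal"
| rel1: "relator1 i j k l $$ s $$ r \<in> rel_ideal"
| rel2: "relator2 i j $ r \<in> rel_ideal"
| add: "x \<in> rel_ideal \<Longrightarrow> y \<in> rel_ideal \<Longrightarrow> x + y \<in> rel_ideal"
| mult_left: "x \<in> rel_ideal \<Longrightarrow> a * x \<in> rel_ideal"
| mult_right: "x \<in> rel_ideal \<Longrightarrow> x * a \<in> rel_ideal"

lemma rel_ideal_uminus: "x \<in> rel_ideal \<Longrightarrow> - x \<in> rel_ideal"
  using rel_ideal.mult_left[of x "- 1"] by simp

lemma rel_ideal_diff: "x \<in> rel_ideal \<Longrightarrow> y \<in> rel_ideal \<Longrightarrow> x - y \<in> rel_ideal"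
  using rel_ideal.add[of x "- y"] rel_ideal_uminus[of y] by simp

subsection \<open>The ideal is homogeneous and proper\<close>

lemma free_induct [case_names single add]:
  fixes x :: free
  assumes single: "\<And>w c. P (Poly_Mapping.single w c)"
    and add: "\<And>x y. P x \<Longrightarrow> P y \<Longrightarrow> P (x + y)"
  shows "P x"
proof (induction x rule: update_induct)
  case const
  show ?case using single[of 0 0] by simp
next
  case (update f a b)
  have "Poly_Mapping.update a b f = f + Poly_Mapping.single a b"
    using update(1)
    by (intro poly_mapping_eqI)
       (auto simp: lookup_update lookup_add lookup_single when_def in_keys_iff)
  thus ?case using update single add by metis
qed

lemma lookup_fcomp: "poly_mapping.lookup (fcomp p x) w = (if wdeg w = p then poly_mapping.lookup x w else 0)"
  by (simp add: fcomp.rep_eq)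

lemma fcomp_add: "fcomp p (x + y) = fcomp p x + fcomp p y"
  by (rule poly_mapping_eqI) (simp add: lookup_fcomp lookup_add)

lemma fcomp_0 [simp]: "fcomp p 0 = 0"
  by (rule poly_mapping_eqI) (simp add: lookup_fcomp)

lemma fcomp_uminus: "fcomp p (- x) = - fcomp p x"
  by (rule poly_mapping_eqI) (simp add: lookup_fcomp)

lemma fcomp_diff: "fcomp p (x - y) = fcomp p x - fcomp p y"
  by (rule poly_mapping_eqI) (simp add: lookup_fcomp lookup_minus)

lemma fcomp_fcomp: "fcomp p (fcomp q x) = (if p = q then fcomp p x else 0)"
  by (rule poly_mapping_eqI) (simp add: lookup_fcomp)

lemma fcomp_decomp: "fcomp 0 x + fcomp 1 x = x"
  by (rule poly_mapping_eqI) (simp add: lookup_fcomp lookup_add)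

lemma fcomp_single:
  "fcomp p (Poly_Mapping.single w c) = (if wdeg w = p then Poly_Mapping.single w c else 0)"
  by (rule poly_mapping_eqI) (auto simp: lookup_fcomp lookup_single when_def)

lemma fcomp_one: "fcomp p 1 = (if p = 0 then 1 else 0)"
  using fcomp_single[of p 0 1] by (cases p) simp_all

lemma fcomp_mult: "fcomp p (x * y) = (\<Sum>q\<in>{0, 1}. fcomp q x * fcomp (p + q) y)"
proof (induction x rule: free_induct)
  case (single w c)
  show ?case
  proof (induction y rule: free_induct)
    case (single w' c')
    show ?case
      by (cases p; cases "wdeg w"; cases "wdeg w'") (simp_all add: mult_single fcomp_single)
  next
    case (add x y)
    thus ?case by (simp add: distrib_left fcomp_add)
  qed
next
  case (add x y)
  thus ?case by (simp add: distrib_right fcomp_add)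
qed

definition homog :: "bit \<Rightarrow> free \<Rightarrow> bool" where
  "homog d x \<longleftrightarrow> fcomp d x = x"

lemma homog_fcomp: "homog d x \<Longrightarrow> fcomp p x = (if p = d then x else 0)"
  unfolding homog_def by (metis fcomp_fcomp)

lemma homog_0: "homog d 0"
  by (simp add: homog_def)

lemma homog_add: "homog d x \<Longrightarrow> homog d y \<Longrightarrow> homog d (x + y)"
  by (simp add: homog_def fcomp_add)

lemma homog_diff: "homog d x \<Longrightarrow> homog d y \<Longrightarrow> homog d (x - y)"
  by (simp add: homog_def fcomp_diff)

lemma homog_uminus: "homog d x \<Longrightarrow> homog d (- x)"
  by (simp add: homog_def fcomp_uminus)

lemma homog_mult: "homog d x \<Longrightarrow> homog e y \<Longrightarrow> homog (d + e) (x * y)"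
  by (cases d; cases e) (simp_all add: homog_def[of _ "x * y"] fcomp_mult homog_fcomp)

lemma homog_gfree: "homog (bar i + bar j) (gfree i j r)"
  by (cases i; cases j)
     (simp_all add: gfree_def homog_def fcomp_one fcomp_single wdeg_def)

definition gcoeff :: "idx \<Rightarrow> idx \<Rightarrow> int \<Rightarrow> free" where
  "gcoeff i j n = (if n < 0 then 0 else gfree i j (nat n))"

lemma homog_gcoeff: "homog (bar i + bar j) (gcoeff i j n)"
  unfolding gcoeff_def by (cases "n < 0") (simp_all only: if_True if_False homog_0 homog_gfree)

lemma in_u_in_v_nth: "(in_u f * in_v g) $$ s $$ r =
    (if r < 0 \<or> s < 0 then 0 else f $ nat r * g $ nat s)"
  by (simp add: in_u_def in_v_def)

lemma in_v_in_u_nth: "(in_v g * in_u f) $$ s $$ r =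
    (if r < 0 \<or> s < 0 then 0 else g $ nat s * f $ nat r)"
  by (simp add: in_u_def in_v_def)

lemma var_u_mult_nth: "(var_u * F) $$ s $$ r = F $$ s $$ (r + 1)"
  by (simp add: var_u_def fls_X_inv_times_conv_shift)

lemma var_v_mult_nth: "(var_v * F) $$ s $$ r = F $$ (s + 1) $$ r"
  by (simp add: var_v_def fls_X_inv_times_conv_shift)

lemma ksign_mult_nth: "(ksign p * F) $$ s $$ r = ksign p * (F $$ s $$ r)"
  by (simp add: ksign_mult)

lemma relator1_nth:
  "relator1 i j k l $$ s $$ r =
    (let B = (\<lambda>r s. gcoeff i j r * gcoeff k l s
                - ksign ((bar i + bar j) * (bar k + bar l)) * (gcoeff k l s * gcoeff i j r));
         N = (\<lambda>r s. gcoeff k j r * gcoeff i l s - gcoeff k j s * gcoeff i l r);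
         M = (\<lambda>r s. gcoeff (- k) j r * gcoeff (- i) l s - gcoeff k (- j) s * gcoeff i (- l) r)
     in ksign (bar i * bar k + bar i * bar l + bar k * bar l) * (B (r + 2) s - B r (s + 2))
        - (N (r + 1) s + N r (s + 1) - ksign (bar k + bar l) * (M (r + 1) s - M r (s + 1))))"
proof -
  have 1: "(in_u (gfree_series a b) * in_v (gfree_series c d)) $$ s $$ r =
      gcoeff a b r * gcoeff c d s" for a b c d r s
    by (simp add: in_u_in_v_nth gcoeff_def gfree_series_def)
  have 2: "(in_v (gfree_series c d) * in_u (gfree_series a b)) $$ s $$ r =
      gcoeff c d s * gcoeff a b r" for a b c d r s
    by (simp add: in_v_in_u_nth gcoeff_def gfree_series_def)
  have 3: "(var_u ^ 2 - var_v ^ 2) * (F :: free fls fls) =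
      var_u * (var_u * F) - var_v * (var_v * F)" for F
    by (simp add: power2_eq_square algebra_simps)
  show ?thesis
    unfolding relator1_def Let_def 3 distrib_right[of var_u var_v] left_diff_distrib[of var_u var_v]
    by (simp add: 1 2 var_u_mult_nth var_v_mult_nth ksign_mult_nth right_diff_distrib add.commute)
qed

lemma homog_gcoeff_mult:
  "d = bar i + bar j + (bar k + bar l) \<Longrightarrow> homog d (gcoeff i j r * gcoeff k l s)"
  by (simp only: homog_mult homog_gcoeff)

lemma homog_ksign: "homog d x \<Longrightarrow> homog d (ksign p * x)"
  by (simp add: ksign_mult homog_uminus)

lemma bar_uminus: "bar (- i) = bar i + 1"
  by (cases i) simp_all

lemma homog_relator1: "homog (bar i + bar j + (bar k + bar l)) (relator1 i j k l $$ s $$ r)"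
  unfolding relator1_nth Let_def
  by (intro homog_diff homog_add homog_ksign homog_gcoeff_mult;
      cases i; cases j; cases k; cases l; simp)

lemma homog_relator2: "homog (bar i + bar j) (relator2 i j $ r)"
proof -
  have "homog (bar i + bar j) (gfree (- i) (- j) r)"
    using homog_gfree[of "- i" "- j" r] by (cases i; cases j) simp_all
  moreover have "homog (bar i + bar j) (gfree i j r * (- 1) ^ r)"
    using homog_gfree[of i j r] by (cases "even r") (simp_all add: homog_uminus)
  ultimately show ?thesis
    by (simp add: relator2_def subst_neg_nth gfree_series_def homog_diff)
qed

lemma rel_ideal_fcomp: "x \<in> rel_ideal \<Longrightarrow> fcomp p x \<in> rel_ideal"
proof (induction arbitrary: p rule: rel_ideal.induct)
  case (rel1 i j k l s r)
  thus ?case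
    using homog_relator1[of i j k l s r] rel_ideal.intros by (simp add: homog_fcomp)
next
  case (rel2 i j r)
  thus ?case
    using homog_relator2[of i j r] rel_ideal.intros by (simp add: homog_fcomp)
qed (simp_all add: fcomp_add fcomp_mult rel_ideal.intros)

lemma lookup_0_mult: "poly_mapping.lookup (x * y :: free) 0 = poly_mapping.lookup x 0 * poly_mapping.lookup y 0"
proof (induction x rule: free_induct)
  case (single w c)
  show ?case
  proof (induction y rule: free_induct)
    case (single w' c')
    show ?case
      by (simp add: mult_single lookup_single when_def)
  next
    case (add x y)
    thus ?case by (simp add: distrib_left lookup_add)
  qed
next
  case (add x y)
  thus ?case by (simp add: distrib_right lookup_add)
qed

lemma lookup_0_gcoeff: "poly_mapping.lookup (gcoeff i j n) 0 = of_bool (i = j \<and> n = 0)"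
  by (auto simp: gcoeff_def gfree_def lookup_single when_def zero_word_def lookup_one)

lemma lookup_0_ksign: "poly_mapping.lookup (ksign p * x :: free) 0 = ksign p * poly_mapping.lookup x 0"
  by (simp add: ksign_mult)

lemma lookup_0_relator1: "poly_mapping.lookup (relator1 i j k l $$ s $$ r) 0 = 0"
  unfolding relator1_nth Let_def
  by (cases i; cases j; cases k; cases l)
     (simp_all add: lookup_minus lookup_add lookup_0_ksign lookup_0_mult lookup_0_gcoeff ksign_def)

lemma lookup_0_relator2: "poly_mapping.lookup (relator2 i j $ r) 0 = 0"
  by (cases i; cases j; cases "even r")
     (auto simp: relator2_def subst_neg_nth gfree_series_def gfree_def lookup_minus
        lookup_single when_def zero_word_def lookup_one odd_pos)

lemma rel_ideal_lookup_0: "x \<in> rel_ideal \<Longrightarrow> poly_mapping.lookup x 0 = 0"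
  by (induction rule: rel_ideal.induct)
     (simp_all add: lookup_0_relator1 lookup_0_relator2 lookup_add lookup_0_mult)

section \<open>The Yangian as a superalgebra\<close>

definition yrel :: "free \<Rightarrow> free \<Rightarrow> bool" where
  "yrel x y \<longleftrightarrow> x - y \<in> rel_ideal"

lemma equivp_yrel: "equivp yrel"
proof (rule equivpI)
  show "reflp yrel"
    by (simp add: reflp_def yrel_def rel_ideal.zero)
  show "symp yrel"
    using rel_ideal_uminus by (fastforce simp: symp_def yrel_def)
  show "transp yrel"
    using rel_ideal.add by (fastforce simp: transp_def yrel_def)
qed

quotient_type yangian = free / yrel
  by (rule equivp_yrel)

instantiation yangian :: ring_1
begin

lift_definition zero_yangian :: yangian is 0 .
lift_definition one_yangian :: yangian is 1 .
lift_definition plus_yangian :: "yangian \<Rightarrow> yangian \<Rightarrow> yangian" is plus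
  unfolding yrel_def using rel_ideal.add by (fastforce simp: algebra_simps)
lift_definition minus_yangian :: "yangian \<Rightarrow> yangian \<Rightarrow> yangian" is minus
  unfolding yrel_def using rel_ideal_diff by (fastforce simp: algebra_simps)
lift_definition uminus_yangian :: "yangian \<Rightarrow> yangian" is uminus
  unfolding yrel_def using rel_ideal_uminus by fastforce
lift_definition times_yangian :: "yangian \<Rightarrow> yangian \<Rightarrow> yangian" is times
proof -
  fix x x' y y' :: free
  assume "yrel x x'" "yrel y y'"
  hence "(x - x') * y + x' * (y - y') \<in> rel_ideal"
    unfolding yrel_def by (intro rel_ideal.add rel_ideal.mult_left rel_ideal.mult_right)
  thus "yrel (x * y) (x' * y')"
    by (simp add: yrel_def algebra_simps)
qed

instance
proof
  show "(0::yangian) \<noteq> 1"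
  proof (transfer, rule notI)
    assume "yrel 0 1"
    thus False
      using rel_ideal_lookup_0[of "0 - 1"] by (simp add: yrel_def lookup_one)
  qed
qed (transfer; simp add: yrel_def algebra_simps rel_ideal.zero)+

end

lift_definition yscalar :: "complex \<Rightarrow> yangian" is "\<lambda>c. Poly_Mapping.single 0 c" .

lemma yscalar_0 [simp]: "yscalar 0 = 0"
  by transfer (simp add: yrel_def rel_ideal.zero)

lift_definition ycomp :: "bit \<Rightarrow> yangian \<Rightarrow> yangian" is fcomp
  by (auto simp: yrel_def simp flip: fcomp_diff intro: rel_ideal_fcomp)

definition superbracket :: "yangian \<Rightarrow> yangian \<Rightarrow> yangian" where
  "superbracket x y = (\<Sum>p\<in>{0, 1}. \<Sum>q\<in>{0, 1}.
     ycomp p x * ycomp q y - ksign (p * q) * (ycomp q y * ycomp p x))"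

lemma ycomp_add: "ycomp p (x + y) = ycomp p x + ycomp p y"
  by transfer (simp add: yrel_def fcomp_add rel_ideal.zero)

lemma ycomp_0 [simp]: "ycomp p 0 = 0"
  by transfer (simp add: yrel_def rel_ideal.zero)

lemma ycomp_uminus: "ycomp p (- x) = - ycomp p x"
  by transfer (simp add: yrel_def fcomp_uminus rel_ideal.zero)

lemma ycomp_one: "ycomp p 1 = (if p = 0 then 1 else 0)"
  by transfer (simp add: yrel_def fcomp_one rel_ideal.zero)

lemma ycomp_ycomp: "ycomp p (ycomp q x) = (if p = q then ycomp p x else 0)"
  by transfer (simp add: yrel_def fcomp_fcomp rel_ideal.zero)

lemma ycomp_decomp: "ycomp 0 x + ycomp 1 x = x"
  by transfer (simp add: yrel_def fcomp_decomp rel_ideal.zero)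

lemma ycomp_mult: "ycomp p (x * y) = ycomp 0 x * ycomp p y + ycomp 1 x * ycomp (p + 1) y"
  by transfer (simp add: yrel_def fcomp_mult rel_ideal.zero)

lift_definition t :: "idx \<Rightarrow> idx \<Rightarrow> nat \<Rightarrow> yangian" is gfree .

definition t_series :: "idx \<Rightarrow> idx \<Rightarrow> yangian fps" where
  "t_series i j = Abs_fps (t i j)"

section \<open>The super tensor product with the endomorphism algebra\<close>

text \<open>The matrix \<open>x\<close> stands for the sum of the elements \<open>E\<^sub>i\<^sub>j \<otimes> x\<^sub>i\<^sub>j\<close> of the super tensor
  product of \<open>End \<complex>\<^sup>1\<^sup>|\<^sup>1\<close> with the Yangian. If \<open>x\<^sub>i\<^sub>j\<close> has degree \<open>p\<close>, then
  \<open>(E\<^sub>i\<^sub>j \<otimes> x\<^sub>i\<^sub>j) (E\<^sub>j\<^sub>l \<otimes> y\<^sub>j\<^sub>l)\<close> carries the sign with exponent \<open>p \<cdot> deg E\<^sub>j\<^sub>l\<close>.\<close>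

typedef smat = "UNIV :: (idx \<Rightarrow> idx \<Rightarrow> yangian) set"
  morphisms entry smat ..

setup_lifting type_definition_smat

instantiation smat :: ring_1
begin

lift_definition zero_smat :: smat is "\<lambda>i j. 0" .
lift_definition one_smat :: smat is "\<lambda>i j. of_bool (i = j)" .
lift_definition plus_smat :: "smat \<Rightarrow> smat \<Rightarrow> smat" is "\<lambda>x y i j. x i j + y i j" .
lift_definition minus_smat :: "smat \<Rightarrow> smat \<Rightarrow> smat" is "\<lambda>x y i j. x i j - y i j" .
lift_definition uminus_smat :: "smat \<Rightarrow> smat" is "\<lambda>x i j. - x i j" .
lift_definition times_smat :: "smat \<Rightarrow> smat \<Rightarrow> smat" is
  "\<lambda>x y i l. \<Sum>j\<in>UNIV. \<Sum>p\<in>{0, 1}. ksign (p * (bar j + bar l)) * (ycomp p (x i j) * y j l)" .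

instance
proof
  show "(0::smat) \<noteq> 1"
    by transfer (auto simp: fun_eq_iff)
  fix a b c :: smat
  show "a * b * c = a * (b * c)"
  proof (transfer, intro ext)
    fix a b c :: "idx \<Rightarrow> idx \<Rightarrow> yangian" and i l
    show "(\<Sum>j\<in>UNIV. \<Sum>p\<in>{0, 1}. ksign (p * (bar j + bar l)) * (ycomp p
             (\<Sum>k\<in>UNIV. \<Sum>p\<in>{0, 1}. ksign (p * (bar k + bar j)) * (ycomp p (a i k) * b k j))
           * c j l)) =
          (\<Sum>j\<in>UNIV. \<Sum>p\<in>{0, 1}. ksign (p * (bar j + bar l)) * (ycomp p (a i j) *
             (\<Sum>k\<in>UNIV. \<Sum>p\<in>{0, 1}. ksign (p * (bar k + bar l)) * (ycomp p (b j k) * c k l))))"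
      by (cases l)
         (simp_all add: UNIV_idx ksign_mult ycomp_add ycomp_uminus ycomp_mult ycomp_ycomp
            algebra_simps)
  qed
  show "1 * a = a"
  proof (transfer, intro ext)
    fix a :: "idx \<Rightarrow> idx \<Rightarrow> yangian" and i l
    show "(\<Sum>j\<in>UNIV. \<Sum>p\<in>{0, 1}. ksign (p * (bar j + bar l)) *
            (ycomp p (of_bool (i = j)) * a j l)) = a i l"
      by (cases i) (simp_all add: UNIV_idx ksign_mult ycomp_one)
  qed
  show "a * 1 = a"
  proof (transfer, intro ext)
    fix a :: "idx \<Rightarrow> idx \<Rightarrow> yangian" and i l
    show "(\<Sum>j\<in>UNIV. \<Sum>p\<in>{0, 1}. ksign (p * (bar j + bar l)) *
            (ycomp p (a i j) * of_bool (j = l))) = a i l"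
      by (cases l) (simp_all add: UNIV_idx ksign_mult ycomp_decomp)
  qed
  show "(a + b) * c = a * c + b * c"
    by transfer
       (simp add: fun_eq_iff ycomp_add distrib_right distrib_left sum.distrib add_ac)
  show "a * (b + c) = a * b + a * c"
    by transfer (simp add: fun_eq_iff distrib_left sum.distrib add_ac)
qed (transfer; simp add: fun_eq_iff algebra_simps)+

end

text \<open>The super tensor product with \<open>Y[[u\<^sup>-\<^sup>1]]\<close> is the ring of power series over \<^typ>\<open>smat\<close>,
  as \<open>u\<close> is even.\<close>

definition T :: "smat fps" where
  "T = Abs_fps (\<lambda>r. smat (\<lambda>i j. t i j r))"

text \<open>The second argument of \<^const>\<open>fps_right_inverse\<close> is an inverse of the constant
  coefficient. Here and below that coefficient is 1, and the result is a two-sided inverse.\<close>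

definition T_inv :: "smat fps" where
  "T_inv = fps_right_inverse T 1"

lemma T_0: "T $ 0 = 1"
proof -
  have "t i j 0 = of_bool (i = j)" for i j
    by (cases "i = j"; simp; transfer; simp add: gfree_def yrel_def rel_ideal.zero)
  thus ?thesis
    by (simp add: T_def one_smat_def)
qed

lemma T_inverse: "T * T_inv = 1" "T_inv * T = 1"
  unfolding T_inv_def by (simp_all add: fps_right_inverse fps_left_inverse'[of 1 T 1] T_0)

definition tt_series :: "idx \<Rightarrow> idx \<Rightarrow> yangian fps" where
  "tt_series i j = Abs_fps (\<lambda>r. entry (T_inv $ r) i j)"

section \<open>The central series\<close>

definition C :: "yangian fps" where
  "C = t_series 1 1 * subst_neg (tt_series 1 1)"

definition D :: "yangian fps" where
  "D = t_series 1 (- 1) * tt_series 1 (- 1)"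

definition \<eta> :: "nat \<Rightarrow> yangian" where
  "\<eta> i = yscalar ((- 1 / 2) ^ i) * (superbracket (t 1 1 2) ^^ i) (t 1 (- 1) 1)"

definition Z_even :: "nat \<Rightarrow> yangian" where
  "Z_even i = yscalar (1 / 2) * superbracket (\<eta> 0) (\<eta> (2 * i))"

definition H :: "yangian fps" where
  "H = Abs_fps (\<lambda>n. if odd n then Z_even (n div 2) else 0)"

definition Q :: "yangian fps" where
  "Q = (1 + H) * fps_right_inverse (1 - H) 1"

lemma H_inverse:
  "(1 - H) * fps_right_inverse (1 - H) 1 = 1" "fps_right_inverse (1 - H) 1 * (1 - H) = 1"
  using fps_right_inverse[of "1 - H" 1] fps_left_inverse'[of 1 "1 - H" 1] by (simp_all add: H_def)

section \<open>Complex series and substitution\<close>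

definition \<delta> :: "complex fls" where
  "\<delta> = 2 * fls_X_inv * fps_to_fls (fps_binomial (1 / 2) oo (fps_const (1 / 4) * fps_X ^ 2))"

definition \<rho> :: "complex fls" where
  "\<rho> = (\<delta> - 1) / 2"

lift_definition yfls :: "complex fls \<Rightarrow> yangian fls" is "\<lambda>f n. yscalar (f n)"
  by (erule eventually_mono) simp

text \<open>Substitution of \<open>w\<close> for \<open>u\<close>: here \<open>w = a u + \<dots>\<close> with \<open>a \<noteq> 0\<close>, so \<open>w\<^sup>-\<^sup>1\<close> is a power
  series in \<open>u\<^sup>-\<^sup>1\<close> without constant term, to be substituted for \<open>u\<^sup>-\<^sup>1\<close>.\<close>

definition subst_u :: "yangian fps \<Rightarrow> complex fls \<Rightarrow> yangian fps" where
  "subst_u f w = f oo fls_regpart (yfls (inverse w))"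

end

theory Submission
  imports Defs
begin

text \<open>Write \<open>a\<close>, \<open>b\<close> for \<open>t\<^sub>1\<^sub>,\<^sub>1(u)\<close>, \<open>t\<^sub>1\<^sub>,\<^sub>-\<^sub>1(u)\<close>, write \<open>\<alpha>\<close>, \<open>\<beta>\<close> for the corresponding entries of
  \<open>T(u)\<^sup>-\<^sup>1\<close>, and let a prime denote the substitution of \<open>-u\<close> for \<open>u\<close>. The remaining entries of the two
  matrices are then \<open>a'\<close>, \<open>b'\<close>, \<open>\<alpha>'\<close>, \<open>\<beta>'\<close>, and \<open>C = a \<alpha>'\<close>, \<open>D = b \<beta>\<close>. Put
  \<open>x = t\<^sub>1\<^sub>,\<^sub>-\<^sub>1\<close> with superscript 1 and \<open>y = t\<^sub>1\<^sub>,\<^sub>1\<close> with superscript 2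
  (\<open>x\<^sub>0\<close>, \<open>y\<^sub>0\<close> in the formal text).

  The elements \<open>Z\<close> are built from \<open>x\<close> and \<open>y\<close> alone. So the proof works with just the coefficients
  of \<open>u\<^sup>-\<^sup>1\<close> and \<open>u\<^sup>-\<^sup>2\<close> of the defining relations between \<open>t\<^sub>i\<^sub>j(u)\<close> and \<open>t\<^sub>k\<^sub>l(v)\<close>, which say how the
  supercommutators with \<open>x\<close> and \<open>y\<close> act on the entries of \<open>T\<close>, hence (Leibniz rule) on those of its inverse. Everything else is algebra
  in the resulting system, collected in the locale \<open>T_system\<close>.

  \<^item> The series \<open>E = b' \<alpha>' + a \<beta>'\<close> satisfies \<open>[y, E] = - 2 u E + E + E'\<close>. Together with
  its mirror image this determines each coefficient of \<open>E\<close> and \<open>E'\<close> from earlier ones, so \<open>E = 0\<close>. By the same argument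
  \<open>C(u) - C(-u) - 4 u D(u)\<close> vanishes and \<open>D\<close> is even. As a consequence, \<open>C\<close> and \<open>D\<close> commute with \<open>x\<close>
  and \<open>y\<close>.

  \<^item> Put \<open>\<eta>(w) = \<Sum> \<eta>\<^sub>i w\<^sup>-\<^sup>i\<^sup>-\<^sup>1\<close>. It is the only solution of \<open>(2 w + ad y) \<eta>(w) = 2 x\<close>, and half of its
  supercommutator with \<open>x\<close> is \<open>H(w)\<close> together with terms in even powers of \<open>w\<close>.

  \<^item> The operator \<open>ad y\<close> maps \<open>p = b \<alpha>\<close> and \<open>q = b' \<alpha>'\<close> to combinations of \<open>p\<close>, \<open>q\<close> and \<open>x\<close> with coefficients
  made from \<open>u\<close>, \<open>C\<close> and \<open>D\<close>. In order that \<open>p + \<mu> q\<close> be mapped by \<open>2 w + ad y\<close> to a multiple of \<open>x\<close>, one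
  needs \<open>(2 w - 1)\<^sup>2 = 1 + 4 u\<^sup>2\<close> and \<open>\<mu> = 2 w - 1 + 2 u\<close>; this is where the square root \<open>\<delta>\<close> comes from.
  With \<open>d = 2 w - 1\<close>, \<open>M = C + (d - 2 u) D\<close> and \<open>N = 1 + d + 2 u\<close> the combination
  \<open>\<zeta> = p + (d + 2 u) q\<close> satisfies \<open>(2 w + ad y) \<zeta> = - N (1 + M) x\<close> and \<open>[x, \<zeta>] = N (M - 1)\<close>.

  \<^item> Uniqueness gives \<open>N (1 + M) \<eta>(w) = - 2 \<zeta>\<close>, and the supercommutator with \<open>x\<close> turns this into
  \<open>(1 + M) H(w) = 1 - M\<close>, that is \<open>M = (1 - H(w)) / (1 + H(w))\<close>. A first use of the identity shows that the
  even powers of \<open>w\<close> do not occur. Since \<open>H\<close> is odd, \<open>d = \<delta>\<close>, \<open>w = \<rho> + 1\<close> yields the second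
  assertion and \<open>d = - \<delta>\<close>, \<open>w = - \<rho>\<close> the first one.\<close>

section \<open>Algebraic consequences of the lowest relations\<close>

lemma cancel_correction:
  fixes u p q r :: "'a::ab_group_add"
  shows "u + p + q = 0 \<Longrightarrow> p + q + r = 0 \<Longrightarrow> u = r"
    and "u + p - q = 0 \<Longrightarrow> p - q + r = 0 \<Longrightarrow> u = r"
  by (simp_all add: algebra_simps) (metis add_left_cancel add.left_commute add.commute)+

text \<open>The entries of \<open>T(u)\<close> and of its inverse, abstractly. The parameter \<open>k\<close> stands for \<open>2 u\<close>, and the
  prime for the substitution of \<open>-u\<close>, which changes the sign of \<open>k\<close>; accordingly the assumptions
  are invariant under exchange of primed and unprimed letters (lemma \<open>bar\<close> below). The signs in the
  inverse relations are those of the super tensor product.\<close>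

locale T_system =
  fixes a a' b b' \<alpha> \<alpha>' \<beta> \<beta>' x y k :: "'r::ring_1"
  assumes right_inverse: "a * \<alpha> - b * \<beta>' = 1" "a * \<beta> + b * \<alpha>' = 0"
      "a' * \<alpha>' - b' * \<beta> = 1" "a' * \<beta>' + b' * \<alpha> = 0"
    and left_inverse: "\<alpha> * a - \<beta> * b' = 1" "\<alpha> * b + \<beta> * a' = 0"
      "\<alpha>' * a' - \<beta>' * b = 1" "\<alpha>' * b' + \<beta>' * a = 0"
    and x_T: "x * a - a * x = - (b + b')" "x * b + b * x = a' - a"
      "x * a' - a' * x = - (b + b')" "x * b' + b' * x = a - a'"
    and y_T: "y * a - a * y = x * b' + b * x" "y * b - b * y = k * b - a * x - x * a'"
      "y * a' - a' * y = x * b + b' * x" "y * b' - b' * y = - (k * b') - a' * x - x * a"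
    and central: "\<And>z. z * k = k * z"

begin

lemma central_left: "z * (k * w) = k * (z * w)"
  by (metis central mult.assoc)

lemmas k_simps = central[of a] central[of a'] central[of b] central[of b']
  central[of \<alpha>] central[of \<alpha>'] central[of \<beta>] central[of \<beta>'] central[of x] central[of y]
  central_left[of a] central_left[of a'] central_left[of b] central_left[of b']
  central_left[of \<alpha>] central_left[of \<alpha>'] central_left[of \<beta>] central_left[of \<beta>']
  central_left[of x] central_left[of y]

lemma bar: "T_system a' a b' b \<alpha>' \<alpha> \<beta>' \<beta> x y (- k)"
  using right_inverse left_inverse x_T y_T central
  by unfold_locales (simp_all add: add.commute)

text \<open>The next four lemmas take supercommutators of the relations \<open>T T\<^sup>-\<^sup>1 = 1\<close> with \<open>x\<close> and \<open>y\<close>. In each of them, two of these relations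
  are multiplied by \<open>\<alpha>\<close> and \<open>\<beta>\<close> in such a way that \<open>T\<^sup>-\<^sup>1 T = 1\<close> isolates the supercommutator
  with the wanted entry (first identity). Inserting the known supercommutators with the entries of \<open>T\<close> leaves
  again a combination of the inverse relations (second identity). The letters \<open>?R\<close> and \<open>?L\<close> abbreviate
  expressions that vanish by the right and left inverse relations.\<close>

lemma x_\<alpha>: "x * \<alpha> - \<alpha> * x = - (\<beta> + \<beta>')"
proof -
  let ?R1 = "a * \<alpha> - b * \<beta>' - 1" and ?R3 = "a' * \<beta>' + b' * \<alpha>"
  let ?L1 = "\<alpha> * a - \<beta> * b' - 1" and ?L2 = "\<alpha> * b + \<beta> * a'"
  have "x * \<alpha> - \<alpha> * x + \<alpha> * ((x * a - a * x) * \<alpha> - (x * b + b * x) * \<beta>')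
      + \<beta> * ((x * b' + b' * x) * \<alpha> + (x * a' - a' * x) * \<beta>') =
    \<alpha> * (x * ?R1 - ?R1 * x) + \<beta> * (x * ?R3 + ?R3 * x) - ?L1 * (x * \<alpha> - \<alpha> * x) - ?L2 * (x * \<beta>' + \<beta>' * x)"
    by (simp add: algebra_simps)
  also have "\<dots> = 0"
    by (simp add: right_inverse left_inverse)
  finally have 1: "x * \<alpha> - \<alpha> * x + \<alpha> * ((x * a - a * x) * \<alpha> - (x * b + b * x) * \<beta>')
      + \<beta> * ((x * b' + b' * x) * \<alpha> + (x * a' - a' * x) * \<beta>') = 0" .
  have "\<alpha> * (- (b + b') * \<alpha> - (a' - a) * \<beta>') + \<beta> * ((a - a') * \<alpha> + - (b + b') * \<beta>')
     + - (\<beta> + \<beta>') = ?L1 * \<beta>' - ?L2 * \<alpha> - \<alpha> * ?R3 + \<beta> * ?R1"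
    by (simp add: algebra_simps)
  also have "\<dots> = 0"
    by (simp add: right_inverse left_inverse)
  finally show ?thesis
    by (rule cancel_correction(1)[OF 1[unfolded x_T]])
qed

lemma x_\<beta>: "x * \<beta> + \<beta> * x = \<alpha>' - \<alpha>"
proof -
  let ?R2 = "a * \<beta> + b * \<alpha>'" and ?R4 = "a' * \<alpha>' - b' * \<beta> - 1"
  let ?L1 = "\<alpha> * a - \<beta> * b' - 1" and ?L2 = "\<alpha> * b + \<beta> * a'"
  have "x * \<beta> + \<beta> * x + \<alpha> * ((x * a - a * x) * \<beta> + (x * b + b * x) * \<alpha>')
      - \<beta> * ((x * a' - a' * x) * \<alpha>' - (x * b' + b' * x) * \<beta>) =
    \<alpha> * (x * ?R2 + ?R2 * x) - \<beta> * (x * ?R4 - ?R4 * x) - ?L1 * (x * \<beta> + \<beta> * x) + ?L2 * (x * \<alpha>' - \<alpha>' * x)"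
    by (simp add: algebra_simps)
  also have "\<dots> = 0"
    by (simp add: right_inverse left_inverse)
  finally have 1: "x * \<beta> + \<beta> * x + \<alpha> * ((x * a - a * x) * \<beta> + (x * b + b * x) * \<alpha>')
      - \<beta> * ((x * a' - a' * x) * \<alpha>' - (x * b' + b' * x) * \<beta>) = 0" .
  have "\<alpha> * (- (b + b') * \<beta> + (a' - a) * \<alpha>')
      - \<beta> * (- (b + b') * \<alpha>' - (a - a') * \<beta>) + (\<alpha>' - \<alpha>)
     = \<alpha> * ?R4 + \<beta> * ?R2 - ?L1 * \<alpha>' - ?L2 * \<beta>"
    by (simp add: algebra_simps)
  also have "\<dots> = 0"
    by (simp add: right_inverse left_inverse)
  finally show ?thesis
    by (rule cancel_correction(2)[OF 1[unfolded x_T]])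
qed

lemma y_\<alpha>: "y * \<alpha> - \<alpha> * y = - (x * \<beta>') - \<beta> * x"
proof -
  let ?R1 = "a * \<alpha> - b * \<beta>' - 1" and ?R3 = "a' * \<beta>' + b' * \<alpha>"
  let ?L1 = "\<alpha> * a - \<beta> * b' - 1" and ?L2 = "\<alpha> * b + \<beta> * a'"
  have "y * \<alpha> - \<alpha> * y + \<alpha> * ((y * a - a * y) * \<alpha> - (y * b - b * y) * \<beta>')
      - \<beta> * ((y * b' - b' * y) * \<alpha> + (y * a' - a' * y) * \<beta>') =
    \<alpha> * (y * ?R1 - ?R1 * y) - \<beta> * (y * ?R3 - ?R3 * y) - ?L1 * (y * \<alpha> - \<alpha> * y) + ?L2 * (y * \<beta>' - \<beta>' * y)"
    by (simp add: algebra_simps)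
  also have "\<dots> = 0"
    by (simp add: right_inverse left_inverse)
  finally have 1: "y * \<alpha> - \<alpha> * y + \<alpha> * ((y * a - a * y) * \<alpha> - (y * b - b * y) * \<beta>')
      - \<beta> * ((y * b' - b' * y) * \<alpha> + (y * a' - a' * y) * \<beta>') = 0" .
  have "\<alpha> * ((x * b' + b * x) * \<alpha> - (k * b - a * x - x * a') * \<beta>')
      - \<beta> * ((- (k * b') - a' * x - x * a) * \<alpha> + (x * b + b' * x) * \<beta>') + (- (x * \<beta>') - \<beta> * x)
     = \<beta> * x * ?R1 + (\<alpha> * x + k * \<beta>) * ?R3 + ?L1 * x * \<beta>' + ?L2 * (x * \<alpha> - k * \<beta>')"
    by (simp add: algebra_simps k_simps)
  also have "\<dots> = 0"
    by (simp add: right_inverse left_inverse)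
  finally show ?thesis
    by (rule cancel_correction(2)[OF 1[unfolded y_T]])
qed

lemma y_\<beta>: "y * \<beta> - \<beta> * y = k * \<beta> + \<alpha> * x + x * \<alpha>'"
proof -
  let ?R2 = "a * \<beta> + b * \<alpha>'" and ?R4 = "a' * \<alpha>' - b' * \<beta> - 1"
  let ?L1 = "\<alpha> * a - \<beta> * b' - 1" and ?L2 = "\<alpha> * b + \<beta> * a'"
  have "y * \<beta> - \<beta> * y + \<alpha> * ((y * a - a * y) * \<beta> + (y * b - b * y) * \<alpha>')
      + \<beta> * ((y * a' - a' * y) * \<alpha>' - (y * b' - b' * y) * \<beta>) =
    \<alpha> * (y * ?R2 - ?R2 * y) + \<beta> * (y * ?R4 - ?R4 * y) - ?L1 * (y * \<beta> - \<beta> * y) - ?L2 * (y * \<alpha>' - \<alpha>' * y)"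
    by (simp add: algebra_simps)
  also have "\<dots> = 0"
    by (simp add: right_inverse left_inverse)
  finally have 1: "y * \<beta> - \<beta> * y + \<alpha> * ((y * a - a * y) * \<beta> + (y * b - b * y) * \<alpha>')
      + \<beta> * ((y * a' - a' * y) * \<alpha>' - (y * b' - b' * y) * \<beta>) = 0" .
  have "\<alpha> * ((x * b' + b * x) * \<beta> + (k * b - a * x - x * a') * \<alpha>')
      + \<beta> * ((x * b + b' * x) * \<alpha>' - (- (k * b') - a' * x - x * a) * \<beta>)
      + (k * \<beta> + \<alpha> * x + x * \<alpha>')
     = \<beta> * x * ?R2 - (\<alpha> * x + k * \<beta>) * ?R4 - ?L1 * x * \<alpha>' + ?L2 * (x * \<beta> + k * \<alpha>')"
    by (simp add: algebra_simps k_simps)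
  also have "\<dots> = 0"
    by (simp add: right_inverse left_inverse)
  finally show ?thesis
    by (rule cancel_correction(1)[OF 1[unfolded y_T]])
qed

lemmas bar_T_inv = T_system.x_\<alpha>[OF bar] T_system.x_\<beta>[OF bar] T_system.y_\<alpha>[OF bar] T_system.y_\<beta>[OF bar]

lemmas T_inv = x_\<alpha> x_\<beta> y_\<alpha> y_\<beta> bar_T_inv

text \<open>The rules below move \<open>x\<close> to the left and \<open>y\<close> to the right of all entries. After that every
  product of an entry of \<open>T\<close> and one of \<open>T\<^sup>-\<^sup>1\<close>, with \<open>x\<close> or \<open>y\<close> inserted anywhere, has a normal form, in which
  the rules \<open>inverse_products\<close> have eliminated four of the sixteen products of entries. Identities between
  such expressions are decided by rewriting.\<close>

lemma x_left: "a * x = x * a + b + b'" "a' * x = x * a' + b + b'"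
    "b * x = a' - a - x * b" "b' * x = a - a' - x * b'"
    "\<alpha> * x = x * \<alpha> + \<beta> + \<beta>'" "\<alpha>' * x = x * \<alpha>' + \<beta> + \<beta>'"
    "\<beta> * x = \<alpha>' - \<alpha> - x * \<beta>" "\<beta>' * x = \<alpha> - \<alpha>' - x * \<beta>'"
  using x_T T_inv(1,2,5,6) by (simp_all add: algebra_simps)

lemma y_right:
    "y * a = a * y + x * b' + b * x" "y * a' = a' * y + x * b + b' * x"
    "y * b = b * y + k * b - a * x - x * a'" "y * b' = b' * y - k * b' - a' * x - x * a"
    "y * \<alpha> = \<alpha> * y - x * \<beta>' - \<beta> * x" "y * \<alpha>' = \<alpha>' * y - x * \<beta> - \<beta>' * x"
    "y * \<beta> = \<beta> * y + k * \<beta> + \<alpha> * x + x * \<alpha>'" "y * \<beta>' = \<beta>' * y - k * \<beta>' + \<alpha>' * x + x * \<alpha>"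
  using y_T T_inv(3,4,7,8) by (simp_all add: algebra_simps)

lemma mult_rule: "p * q = r \<Longrightarrow> p * (q * s) = r * s" for p q r s :: 'r
  by (simp add: mult.assoc[symmetric])

lemma products: "b * \<beta>' = a * \<alpha> - 1" "b' * \<beta> = a' * \<alpha>' - 1" 
    "a * \<beta> = - (b * \<alpha>')" "a' * \<beta>' = - (b' * \<alpha>)"
  using right_inverse by (simp_all add: algebra_simps eq_neg_iff_add_eq_0)

lemmas normalise = algebra_simps k_simps x_left x_left[THEN mult_rule] y_right y_right[THEN mult_rule]
  products products[THEN mult_rule]

text \<open>The first expression is \<open>- [x, a \<alpha>']\<close>, and the second one its mirror image, so both vanish in the Yangian
  because \<open>C = a \<alpha>'\<close> is central. A direct reason is found in the two equations \<open>y_crossed\<close> and \<open>y_crossed'\<close>: multiplication by \<open>k\<close>, that is by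
  \<open>2 u\<close>, lowers the order of a Laurent series in \<open>u\<^sup>-\<^sup>1\<close>, while the order of the other terms is not lower than that of the
  two series.\<close>

definition crossed where "crossed = b' * \<alpha>' + a * \<beta>'"

definition crossed' where "crossed' = b * \<alpha> + a' * \<beta>"

lemma y_crossed: "y * crossed - crossed * y = - (k * crossed) + crossed + crossed'"
  by (simp add: crossed_def crossed'_def normalise)

lemma y_crossed': "y * crossed' - crossed' * y = k * crossed' + crossed + crossed'"
  by (simp add: crossed_def crossed'_def normalise)

end

locale T_system_reduced = T_system +
  assumes crossed_products: "a * \<beta>' = - (b' * \<alpha>')" "a' * \<beta> = - (b * \<alpha>)"

begin

lemmas normalise_reduced = normalise crossed_products crossed_products[THEN mult_rule]

lemma x_C: "x * (a * \<alpha>') = a * \<alpha>' * x"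
  by (simp add: normalise_reduced)

lemma x_D: "x * (b * \<beta>) = b * \<beta> * x"
  by (simp add: normalise_reduced)

lemma y_C: "y * (a * \<alpha>') - a * \<alpha>' * y = b' * \<beta>' - b * \<beta>"
  by (simp add: normalise_reduced)

lemma y_D: "y * (b * \<beta>) - b * \<beta> * y = k * (b * \<beta>) + k * (b * \<beta>) + a' * \<alpha> - a * \<alpha>'"
  by (simp add: normalise_reduced)

lemma x_p: "x * (b * \<alpha>) + b * \<alpha> * x = a' * \<alpha> + b * \<beta> - 1"
  by (simp add: normalise_reduced)

lemma x_q: "x * (b' * \<alpha>') + b' * \<alpha>' * x = a * \<alpha>' + b' * \<beta>' - 1"
  by (simp add: normalise_reduced)

lemma y_p: "y * (b * \<alpha>) - b * \<alpha> * y = k * (b * \<alpha>) - b * \<alpha> - b' * \<alpha>' - (1 + a' * \<alpha> + b * \<beta>) * x"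
  by (simp add: normalise_reduced)

lemma y_q: "y * (b' * \<alpha>') - b' * \<alpha>' * y = - (k * (b' * \<alpha>')) - b * \<alpha> - b' * \<alpha>' - (1 + a * \<alpha>' + b' * \<beta>') * x"
  by (simp add: normalise_reduced)

lemma bar_central: "T_system_reduced a' a b' b \<alpha>' \<alpha> \<beta>' \<beta> x y (- k)"
  by (intro T_system_reduced.intro bar T_system_reduced_axioms.intro crossed_products)

text \<open>The series \<open>C(u) - C(-u) - 4 u D(u)\<close>. Since it is also \<open>- [y, D]\<close>, its vanishing shows in addition that \<open>D\<close>
  commutes with \<open>y\<close>.\<close>

definition defect where
  "defect = a * \<alpha>' - a' * \<alpha> - k * (b * \<beta>) - k * (b * \<beta>)"

lemma y_D_defect: "y * (b * \<beta>) - b * \<beta> * y = - defect"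
  unfolding y_D defect_def by (simp add: algebra_simps)

text \<open>The difference \<open>D(-u) - D(u)\<close>, which enters the commutator of \<open>y\<close> with the defect, is expressed through the defect
  and its mirror image at the cost of a factor \<open>k\<close>. This makes the system closed, so that it can be solved
  recursively for the coefficients.\<close>

lemma y_defect:
  defines "F' \<equiv> a' * \<alpha> - a * \<alpha>' + k * (b' * \<beta>') + k * (b' * \<beta>')"
  shows "k * (y * defect - defect * y) = defect + F' + k * (k * defect) + k * (k * defect)"
proof -
  have kl: "k * z = z * k" for z
    by (simp add: central)
  have "y * defect - defect * y = (y * (a * \<alpha>') - a * \<alpha>' * y) - (y * (a' * \<alpha>) - a' * \<alpha> * y)
     - k * (y * (b * \<beta>) - b * \<beta> * y) - k * (y * (b * \<beta>) - b * \<beta> * y)"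
    by (simp add: defect_def algebra_simps k_simps)
  also have "\<dots> = (b' * \<beta>' - b * \<beta>) + (b' * \<beta>' - b * \<beta>) + k * defect + k * defect"
    unfolding y_C y_D_defect T_system_reduced.y_C[OF bar_central] by simp
  finally show ?thesis
    by (simp only: distrib_left) (simp add: defect_def F'_def algebra_simps)
qed

end

text \<open>The letters have the meaning \<open>p = b \<alpha>\<close> and \<open>q = b' \<alpha>'\<close>, and \<open>C(-u)\<close> has been replaced by \<open>C - 2 k D\<close>. On the
  left hand side of the first conclusion \<open>p\<close> cancels by the choice of the coefficient \<open>d + k\<close> in \<open>\<zeta>\<close>, and \<open>q\<close>
  cancels because \<open>d\<^sup>2 = 1 + k\<^sup>2\<close>. The common factor \<open>1 + d + k\<close>
  splits off by the same equation.\<close>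

lemma inhomogeneous_equation_\<zeta>:
  fixes p q x y C D d k :: "'r::ring_1"
  assumes k: "\<And>z. z * k = k * z" and d: "\<And>z. z * d = d * z" "d * d = 1 + k * k"
   and y: "y * p - p * y = k * p - p - q - (1 + (C - k * D - k * D) + D) * x"
       "y * q - q * y = - (k * q) - p - q - (1 + C + D) * x"
   and x: "x * p + p * x = (C - k * D - k * D) + D - 1" "x * q + q * x = C + D - 1"
  defines "\<zeta> \<equiv> p + (d + k) * q" and "M \<equiv> C + (d - k) * D"
  shows "(d + 1) * \<zeta> + (y * \<zeta> - \<zeta> * y) = - ((1 + d + k) * (1 + M) * x)"
    and "x * \<zeta> + \<zeta> * x = (1 + d + k) * (M - 1)"
proof -
  have kl: "z * (k * w) = k * (z * w)" and dl: "z * (d * w) = d * (z * w)" for z w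
    by (metis d(1) k mult.assoc)+
  have dd: "d * (d * z) = z + k * (k * z)" for z
    by (simp add: mult.assoc[symmetric] d(2)) (simp add: algebra_simps)
  note move = algebra_simps kl[of y] kl[of x] k[of y] k[of x]
    dl[of y] dl[of x] dl[of k] d(1)[of y] d(1)[of x] d(1)[of k] d(2) dd
  have 1: "y * \<zeta> - \<zeta> * y = (y * p - p * y) + (d + k) * (y * q - q * y)"
    by (simp add: \<zeta>_def move)
  show "(d + 1) * \<zeta> + (y * \<zeta> - \<zeta> * y) = - ((1 + d + k) * (1 + M) * x)"
    unfolding 1 y unfolding \<zeta>_def M_def by (simp add: move)
  have 2: "x * \<zeta> + \<zeta> * x = (x * p + p * x) + (d + k) * (x * q + q * x)"
    by (simp add: \<zeta>_def move)
  show "x * \<zeta> + \<zeta> * x = (1 + d + k) * (M - 1)"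
    unfolding 2 x M_def by (simp add: move)
qed

text \<open>Here \<open>\<theta>\<close> is going to be the generating series of the \<open>\<eta>\<^sub>i\<close>. The combination \<open>\<Delta>\<close> is made to satisfy the homogeneous
  equation, whose only solution is zero.\<close>

lemma homogeneous_equation_\<Delta>:
  fixes \<zeta> \<theta> M n d x y :: "'r::ring_1"
  assumes central: "\<And>z. z * n = n * z" "\<And>z. z * d = d * z"
    and M: "x * M = M * x" "y * M = M * y"
    and \<zeta>: "(d + 1) * \<zeta> + (y * \<zeta> - \<zeta> * y) = - (n * (1 + M) * x)"
    and \<theta>: "(d + 1) * \<theta> + (y * \<theta> - \<theta> * y) = x + x"
  defines "\<Delta> \<equiv> n * (1 + M) * \<theta> + \<zeta> + \<zeta>"
  shows "(d + 1) * \<Delta> + (y * \<Delta> - \<Delta> * y) = 0"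
    and "x * \<Delta> + \<Delta> * x = n * (1 + M) * (x * \<theta> + \<theta> * x) + (x * \<zeta> + \<zeta> * x) + (x * \<zeta> + \<zeta> * x)"
proof -
  let ?P = "n * (1 + M)"
  have P: "x * ?P = ?P * x" "y * ?P = ?P * y"
    using M central(1)[of x] central(1)[of y]
    by (simp_all add: distrib_left distrib_right mult.assoc) (metis mult.assoc)+
  have "(d + 1) * \<Delta> + (y * \<Delta> - \<Delta> * y) =
    ?P * ((d + 1) * \<theta> + (y * \<theta> - \<theta> * y))
    + ((d + 1) * \<zeta> + (y * \<zeta> - \<zeta> * y)) + ((d + 1) * \<zeta> + (y * \<zeta> - \<zeta> * y))
    + (d * ?P - ?P * d) * \<theta> + (y * ?P - ?P * y) * \<theta>"
    unfolding \<Delta>_def by (simp add: algebra_simps)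
  also have "\<dots> = 0"
    unfolding \<zeta> \<theta> P central(2)[of ?P] by (simp add: algebra_simps)
  finally show "(d + 1) * \<Delta> + (y * \<Delta> - \<Delta> * y) = 0" .
  have "x * \<Delta> + \<Delta> * x = ?P * (x * \<theta> + \<theta> * x) + (x * \<zeta> + \<zeta> * x) + (x * \<zeta> + \<zeta> * x)
    + (x * ?P - ?P * x) * \<theta>"
    unfolding \<Delta>_def by (simp add: algebra_simps)
  thus "x * \<Delta> + \<Delta> * x = ?P * (x * \<theta> + \<theta> * x) + (x * \<zeta> + \<zeta> * x) + (x * \<zeta> + \<zeta> * x)"
    unfolding P by simp
qed

section \<open>Series over a noncommutative ring\<close>

text \<open>For \<open>n \<le> N\<close> the summation may be extended to a range that does not depend on \<open>n\<close>, which makes the double sums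
  in the product rule below manageable.\<close>

lemma compose_nth_le:
  fixes f h :: "'a::ring_1 fps"
  assumes "h $ 0 = 0" "n \<le> N"
  shows "(f oo h) $ n = (\<Sum>i\<le>N. f $ i * (h ^ i) $ n)"
  unfolding fps_compose_nth atLeast0AtMost
  using assms by (intro sum.mono_neutral_left) (auto simp: startsby_zero_power_prefix)

lemma power_central:
  fixes h :: "'a::ring_1 fps"
  assumes "\<And>m c. c * h $ m = h $ m * c"
  shows "c * (h ^ i) $ n = (h ^ i) $ n * c"
proof (induction i arbitrary: n)
  case (Suc i)
  thus ?case
    unfolding power_Suc fps_mult_nth sum_distrib_left sum_distrib_right
    by (intro sum.cong refl) (simp add: mult.assoc[symmetric] assms, simp add: mult.assoc Suc)
qed simp

text \<open>Composition with \<open>h\<close> respects products even over a noncommutative ring, provided that the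
  coefficients of \<open>h\<close> are central: they then move past the coefficients of \<open>g\<close>.\<close>

lemma compose_mult:
  fixes f g h :: "'a::ring_1 fps"
  assumes h: "h $ 0 = 0" "\<And>m c. c * h $ m = h $ m * c"
  shows "(f * g) oo h = (f oo h) * (g oo h)"
proof (rule fps_ext)
  fix n
  have move: "p * (h ^ i) $ k * (q * r) = p * q * ((h ^ i) $ k * r)" for p q r i k
  proof -
    have "p * (h ^ i) $ k * (q * r) = p * ((h ^ i) $ k * q) * r"
      by (simp only: mult.assoc)
    thus ?thesis
      by (simp only: power_central[of h q, OF h(2), symmetric] mult.assoc)
  qed
  have high: "i \<le> n" if "p * (h ^ i) $ n \<noteq> 0" for i p
    using that startsby_zero_power_prefix[OF h(1)] by (cases "i \<le> n") auto
  have "((f oo h) * (g oo h)) $ n =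
    (\<Sum>k\<le>n. (\<Sum>i\<le>n. f $ i * (h ^ i) $ k) * (\<Sum>j\<le>n. g $ j * (h ^ j) $ (n - k)))"
    unfolding fps_mult_nth atLeast0AtMost
    by (intro sum.cong refl arg_cong2[of _ _ _ _ "(*)"] compose_nth_le h(1)) auto
  also have "\<dots> = (\<Sum>k\<le>n. \<Sum>i\<le>n. \<Sum>j\<le>n. f $ i * g $ j * ((h ^ i) $ k * (h ^ j) $ (n - k)))"
    unfolding sum_product by (intro sum.cong refl move)
  also have "\<dots> = (\<Sum>i\<le>n. \<Sum>j\<le>n. \<Sum>k\<le>n. f $ i * g $ j * ((h ^ i) $ k * (h ^ j) $ (n - k)))"
    by (rule trans[OF sum.swap]) (intro sum.cong refl sum.swap)
  also have "\<dots> = (\<Sum>i\<le>n. \<Sum>j\<le>n. f $ i * g $ j * (h ^ (i + j)) $ n)"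
    by (simp add: power_add fps_mult_nth atLeast0AtMost sum_distrib_left)
  also have "\<dots> = (\<Sum>(i, j)\<in>{..n} \<times> {..n}. f $ i * g $ j * (h ^ (i + j)) $ n)"
    by (simp add: sum.cartesian_product)
  also have "\<dots> = (\<Sum>(i, j)\<in>{(i, j). i + j \<le> n}. f $ i * g $ j * (h ^ (i + j)) $ n)"
    by (intro sum.mono_neutral_right) (auto dest: high)
  also have "\<dots> = (\<Sum>m\<le>n. \<Sum>i\<le>m. f $ i * g $ (m - i) * (h ^ m) $ n)"
    by (subst sum.triangle_reindex_eq[of "\<lambda>i j. f $ i * g $ j * (h ^ (i + j)) $ n"]) simp
  also have "\<dots> = ((f * g) oo h) $ n"
    by (simp add: fps_compose_nth fps_mult_nth atLeast0AtMost sum_distrib_right)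
  finally show "((f * g) oo h) $ n = ((f oo h) * (g oo h)) $ n" ..
qed

lemma compose_eq_0D:
  assumes "h $ 0 = 0" "h $ 1 = (1::'a::ring_1)" "f oo h = 0"
  shows "f = 0"
proof (rule fps_ext)
  fix n show "f $ n = 0 $ n"
  proof (induction n rule: less_induct)
    case (less n)
    have "(f oo h) $ n = (\<Sum>i\<in>{n}. f $ i * (h ^ i) $ n)"
      unfolding fps_compose_nth using less by (intro sum.mono_neutral_right) auto
    also have "\<dots> = f $ n"
      using startsby_zero_power_nth_same[OF assms(1)] assms(2) by simp
    finally show ?case
      using assms(3) by simp
  qed
qed

lemma fps_const_compose_any: "fps_const z oo h = (fps_const z :: 'a::ring_1 fps)"
  by (rule fps_ext) (auto simp: fps_compose_nth intro!: sum.neutral)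

text \<open>A matrix of power series that is the identity modulo \<open>u\<^sup>-\<^sup>1\<close> has no kernel. This serves to turn right
  inverses into left inverses, and to prove uniqueness of inverses.\<close>

lemma fps_matrix_kernel:
  fixes p q r s f g :: "'a::ring_1 fps"
  assumes "p $ 0 = 1" "q $ 0 = 0" "r $ 0 = 0" "s $ 0 = 1"
    and "p * f + q * g = 0" "r * f + s * g = 0"
  shows "f = 0 \<and> g = 0"
proof -
  have "f $ n = 0 \<and> g $ n = 0" for n
  proof (induction n rule: less_induct)
    case (less n)
    have *: "(p * f) $ n = p $ 0 * f $ n" if "\<And>m. m < n \<Longrightarrow> f $ m = 0" for p f :: "'a fps"
      unfolding fps_mult_nth
      using that by (subst sum.mono_neutral_right[of _ "{0}"]) auto
    show ?case
      using assms(5,6)[THEN arg_cong, of "\<lambda>f. f $ n"] assms(1-4)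
      by (simp add: * less)
  qed
  thus ?thesis
    by (simp add: fps_eq_iff)
qed

text \<open>Laurent series have finitely many terms of negative index, so the induction has a place to start. Two series
  are treated simultaneously because the equations for a series and its mirror image are coupled.\<close>

lemma fls_pair_zeroI:
  fixes f g :: "'a::zero fls"
  assumes "\<And>n. (\<And>m. m < n \<Longrightarrow> f $$ m = 0 \<and> g $$ m = 0) \<Longrightarrow> f $$ n = 0 \<and> g $$ n = 0"
  shows "f = 0" "g = 0"
proof -
  define N where "N = min (fls_subdegree f) (fls_subdegree g)"
  have "f $$ n = 0 \<and> g $$ n = 0" for n
  proof (induction "nat (n - N)" arbitrary: n rule: less_induct)
    case less
    show ?case
    proof (cases "n < N")
      case False
      show ?thesis
      proof (rule assms)
        fix m assume "m < n"
        thus "f $$ m = 0 \<and> g $$ m = 0"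
          using less[of m] False by (cases "m < N") (auto simp: N_def)
      qed
    qed (simp add: N_def)
  qed
  thus "f = 0" "g = 0"
    by (auto intro: fls_eqI)
qed

text \<open>The commutator with \<open>y\<close> does not lower the order of \<open>\<Delta>\<close>, and \<open>w\<close>
  raises it.\<close>

lemma commutator_contraction:
  fixes w y \<Delta> :: "'a::ring_1 fls"
  assumes "fls_subdegree w \<ge> 1" "fls_subdegree y \<ge> 0" "\<Delta> = w * (y * \<Delta> - \<Delta> * y)"
  shows "\<Delta> = 0"
proof (rule ccontr)
  assume nz: "\<Delta> \<noteq> 0"
  let ?c = "y * \<Delta> - \<Delta> * y"
  have c: "?c \<noteq> 0"
    using nz assms(3) by auto
  have "?c $$ n = 0" if "n < fls_subdegree \<Delta>" for n
    using that assms(2) fls_times_nth_eq0[of n y \<Delta>] fls_times_nth_eq0[of n \<Delta> y] by simp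
  hence "fls_subdegree ?c \<ge> fls_subdegree \<Delta>"
    by (intro fls_subdegree_geI c) 
  moreover have "fls_subdegree \<Delta> \<ge> fls_subdegree w + fls_subdegree ?c"
    using fls_mult_subdegree_ge[of w ?c] nz assms(3) by simp
  ultimately show False
    using assms(1) by simp
qed

text \<open>The coefficient with index \<open>-1\<close> is singled out because multiplication by \<open>u\<close> moves the constant
  coefficient there.\<close>

lemma fls_eqI_from_minus_1:
  assumes "\<And>n. n < - 1 \<Longrightarrow> f $$ n = g $$ n" "f $$ (- 1) = g $$ (- 1)" "\<And>m. f $$ int m = g $$ int m"
  shows "f = g"
proof (rule fls_eqI)
  fix n :: int
  have "n < - 1 \<or> n = - 1 \<or> (\<exists>m. n = int m)"
    by presburger
  thus "f $$ n = g $$ n"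
    using assms by auto
qed

section \<open>Scalars in the Yangian\<close>

lemma yscalar_add: "yscalar (c + d) = yscalar c + yscalar d"
  by transfer (simp add: yrel_def single_add rel_ideal.zero)

lemma yscalar_mult: "yscalar (c * d) = yscalar c * yscalar d"
  by transfer (simp add: yrel_def mult_single rel_ideal.zero)

lemma yscalar_1 [simp]: "yscalar 1 = 1"
  by transfer (simp add: yrel_def rel_ideal.zero)

lemma yscalar_uminus: "yscalar (- c) = - yscalar c"
  using yscalar_add[of c "- c"] by (simp add: eq_neg_iff_add_eq_0 add.commute)

lemma yscalar_sum: "yscalar (sum f A) = (\<Sum>i\<in>A. yscalar (f i))"
  by (induction A rule: infinite_finite_induct) (simp_all add: yscalar_add)

lemma single_0_commute: "Poly_Mapping.single 0 c * x = x * (Poly_Mapping.single 0 c :: free)"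
  by (induction x rule: free_induct) (simp_all add: mult_single algebra_simps)

lemma yscalar_commute: "yscalar c * x = x * yscalar c"
  by transfer (simp add: yrel_def single_0_commute rel_ideal.zero)

lemma yscalar_mult_eq_0_iff [simp]: "yscalar c * x = 0 \<longleftrightarrow> c = 0 \<or> x = 0"
proof -
  have "x = 0" if "c \<noteq> 0" "yscalar c * x = 0"
  proof -
    have "yscalar (inverse c) * (yscalar c * x) = x"
      using that(1) by (simp flip: mult.assoc yscalar_mult)
    with that(2) show ?thesis by simp
  qed
  thus ?thesis by auto
qed

lemma yscalar_eq_0_iff [simp]: "yscalar c = 0 \<longleftrightarrow> c = 0"
  using yscalar_mult_eq_0_iff[of c 1] by (simp del: yscalar_mult_eq_0_iff)

lemma yscalar_2: "yscalar 2 = 2"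
  using yscalar_add[of 1 1] by simp

lemma add_self_eq_0_iff [simp]: "x + x = 0 \<longleftrightarrow> (x :: yangian) = 0"
  using yscalar_mult_eq_0_iff[of 2 x] by (simp add: yscalar_2 mult_2 del: yscalar_mult_eq_0_iff)

lemma neg_eq_self_iff [simp]: "- x = x \<longleftrightarrow> (x :: yangian) = 0"
  by (simp add: neg_eq_iff_add_eq_0)

lemma yfls_nth [simp]: "yfls f $$ n = yscalar (f $$ n)"
  by transfer simp

lemma yfls_add: "yfls (f + g) = yfls f + yfls g"
  by (rule fls_eqI) (simp add: yscalar_add)

lemma yfls_uminus: "yfls (- f) = - yfls f"
  by (rule fls_eqI) (simp add: yscalar_uminus)

lemma yfls_diff: "yfls (f - g) = yfls f - yfls g"
  using yfls_add[of f "- g"] by (simp add: yfls_uminus)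

lemma yfls_0 [simp]: "yfls 0 = 0"
  by (rule fls_eqI) simp

lemma yfls_1 [simp]: "yfls 1 = 1"
  by (rule fls_eqI) simp

lemma yfls_X_inv [simp]: "yfls fls_X_inv = fls_X_inv"
  by (rule fls_eqI) simp

lemma subdegree_yfls: "fls_subdegree (yfls f) = fls_subdegree f"
proof (cases "f = 0")
  case False
  thus ?thesis
    by (intro fls_subdegree_eqI) simp_all
qed simp

lemma yfls_mult: "yfls (f * g) = yfls f * yfls g"
  by (rule fls_eqI) (simp add: fls_times_nth(2) subdegree_yfls yscalar_sum yscalar_mult)

lemma yfls_commute: "yfls f * F = F * yfls f"
proof (rule fls_eqI)
  fix n
  have "(yfls f * F) $$ n = (\<Sum>i = fls_subdegree f..n - fls_subdegree F. F $$ (n - i) * yscalar (f $$ i))"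
    by (simp add: fls_times_nth(2) subdegree_yfls yscalar_commute)
  also have "\<dots> = (\<Sum>i = fls_subdegree F..n - fls_subdegree f. F $$ i * yscalar (f $$ (n - i)))"
    by (rule sum.reindex_bij_witness[of _ "\<lambda>i. n - i" "\<lambda>i. n - i"]) auto
  also have "\<dots> = (F * yfls f) $$ n"
    by (simp add: fls_times_nth(2) subdegree_yfls)
  finally show "(yfls f * F) $$ n = (F * yfls f) $$ n" .
qed

lemma yfls_cancel:
  assumes "f \<noteq> 0" "yfls f * F = yfls f * G"
  shows "F = G"
proof -
  have "yfls (inverse f) * (yfls f * F) = F" for F
    using assms(1) by (simp flip: mult.assoc yfls_mult)
  thus ?thesis
    using assms(2) by metis
qed

section \<open>The lowest defining relations\<close>

text \<open>Coefficients of \<open>t\<^sub>i\<^sub>j(u)\<close> with integer index. The relators are the relations multiplied by \<open>u\<^sup>2 - v\<^sup>2\<close>, so the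
  coefficients of \<open>u\<^sup>-\<^sup>1\<close> and \<open>u\<^sup>-\<^sup>2\<close> in the original relations are found at \<open>r = -1\<close> and \<open>r = 0\<close>
  in \<open>relation1\<close>, where some of the indices are negative.\<close>

definition tc :: "idx \<Rightarrow> idx \<Rightarrow> int \<Rightarrow> yangian" where
  "tc i j n = (if n < 0 then 0 else t i j (nat n))"

lemma t_0: "t i j 0 = of_bool (i = j)"
  by (cases "i = j"; simp; transfer; simp add: gfree_def yrel_def rel_ideal.zero)

lemma tc_abs: "tc i j n = abs_yangian (gcoeff i j n)"
  by (auto simp: tc_def gcoeff_def t.abs_eq zero_yangian.abs_eq)

lemma abs_ksign: "abs_yangian (ksign p) = ksign p"
  by (simp add: ksign_def one_yangian.abs_eq uminus_yangian.abs_eq)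

lemma relation1:
  "(let B = (\<lambda>r s. tc i j r * tc k l s
                - ksign ((bar i + bar j) * (bar k + bar l)) * (tc k l s * tc i j r));
         N = (\<lambda>r s. tc k j r * tc i l s - tc k j s * tc i l r);
         M = (\<lambda>r s. tc (- k) j r * tc (- i) l s - tc k (- j) s * tc i (- l) r)
     in ksign (bar i * bar k + bar i * bar l + bar k * bar l) * (B (r + 2) s - B r (s + 2))
        - (N (r + 1) s + N r (s + 1) - ksign (bar k + bar l) * (M (r + 1) s - M r (s + 1)))) = 0"
proof -
  have "abs_yangian (relator1 i j k l $$ s $$ r) = 0"
    using rel_ideal.rel1[of i j k l s r] by (simp add: zero_yangian.abs_eq yangian.abs_eq_iff yrel_def)
  thus ?thesis
    unfolding relator1_nth Let_def tc_abs
    by (simp only: abs_ksign minus_yangian.abs_eq[symmetric] plus_yangian.abs_eq[symmetric]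
        times_yangian.abs_eq[symmetric])
qed

lemma t_minus: "t (- i) (- j) r = t i j r * (- 1) ^ r"
proof -
  have "abs_yangian (relator2 i j $ r) = 0"
    using rel_ideal.rel2[of i j r] by (simp add: zero_yangian.abs_eq yangian.abs_eq_iff yrel_def)
  hence "abs_yangian (gfree i j r * (- 1) ^ r) = abs_yangian (gfree (- i) (- j) r)"
    by (simp add: relator2_def subst_neg_nth gfree_series_def minus_yangian.abs_eq[symmetric])
  thus ?thesis
    by (cases "even r") (simp_all add: t.abs_eq uminus_yangian.abs_eq[symmetric])
qed

abbreviation "x\<^sub>0 \<equiv> t Pos Neg 1"

abbreviation "y\<^sub>0 \<equiv> t Pos Pos 2"

lemma t_Neg_Pos_1: "t Neg Pos (Suc 0) = - t Pos Neg (Suc 0)"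
  using t_minus[of Pos Neg 1] by simp

lemma x_t_Pos_Pos: "x\<^sub>0 * t Pos Pos s - t Pos Pos s * x\<^sub>0 = - (t Pos Neg s + t Neg Pos s)"
  using relation1[of Pos Neg Pos Pos "-1" "int s"]
  by (simp add: tc_def t_0 ksign_def algebra_simps)

lemma x_t_Pos_Neg: "x\<^sub>0 * t Pos Neg s + t Pos Neg s * x\<^sub>0 = t Neg Neg s - t Pos Pos s"
  using relation1[of Pos Neg Pos Neg "-1" "int s"]
  by (simp add: tc_def t_0 ksign_def algebra_simps)

text \<open>The coefficient of \<open>u\<^sup>-\<^sup>2\<close> in the relations contains the commutator with \<open>t\<^sub>1\<^sub>,\<^sub>1\<close> of superscript 1, which
  vanishes.\<close>

lemma t_Pos_Pos_1_commute: "t Pos Pos 1 * t Pos Pos s = t Pos Pos s * t Pos Pos 1"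
   "t Pos Pos 1 * t Pos Neg s = t Pos Neg s * t Pos Pos 1"
  using relation1[of Pos Pos Pos Pos "-1" "int s"] relation1[of Pos Pos Pos Neg "-1" "int s"]
  by (simp_all add: tc_def t_0 ksign_def algebra_simps)

lemma y_t_Pos_Pos: "y\<^sub>0 * t Pos Pos s - t Pos Pos s * y\<^sub>0 = x\<^sub>0 * t Neg Pos s + t Pos Neg s * x\<^sub>0"
  using relation1[of Pos Pos Pos Pos "0" "int s"] t_Pos_Pos_1_commute(1)[of s] t_Neg_Pos_1
  by (simp add: tc_def t_0 ksign_def algebra_simps nat_add_distrib)

lemma y_t_Pos_Neg: "y\<^sub>0 * t Pos Neg s - t Pos Neg s * y\<^sub>0 =
  t Pos Neg (Suc s) + t Pos Neg (Suc s) - t Pos Pos s * x\<^sub>0 - x\<^sub>0 * t Neg Neg s"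
  using relation1[of Pos Pos Pos Neg "0" "int s"] t_Pos_Pos_1_commute(2)[of s] t_Neg_Pos_1
  by (simp add: tc_def t_0 ksign_def algebra_simps nat_add_distrib)

text \<open>The relations for the entries in the second row are those for the first row with \<open>-u\<close> in place of \<open>u\<close>;
  coefficientwise this is multiplication by the central sign \<open>(-1)\<^sup>s\<close>.\<close>

lemma t_Neg: "t Neg Neg s = t Pos Pos s * (-1) ^ s" "t Neg Pos s = t Pos Neg s * (-1) ^ s"
  using t_minus[of Pos Pos s] t_minus[of Pos Neg s] by simp_all

lemma t_minus_sign:
  defines "\<And>s. c s \<equiv> (- 1 :: yangian) ^ s"
  shows "t Neg Neg s = t Pos Pos s * c s" "t Neg Pos s = t Pos Neg s * c s"
    "t Pos Pos s = t Neg Neg s * c s" "t Pos Neg s = t Neg Pos s * c s"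
    "z * (w * c s) - w * c s * z = (z * w - w * z) * c s"
    "z * (w * c s) + w * c s * z = (z * w + w * z) * c s"
    "c (Suc s) = - c s"
  unfolding c_def t_Neg
  by (cases "even s"; simp)+

lemma x_t_Neg: "x\<^sub>0 * t Neg Neg s - t Neg Neg s * x\<^sub>0 = - (t Pos Neg s + t Neg Pos s)"
  "x\<^sub>0 * t Neg Pos s + t Neg Pos s * x\<^sub>0 = t Pos Pos s - t Neg Neg s"
proof -
  note c = t_minus_sign(5,6)[of "x\<^sub>0" _ s]
  have "x\<^sub>0 * t Neg Neg s - t Neg Neg s * x\<^sub>0 = - (t Pos Neg s + t Neg Pos s) * (- 1) ^ s"
    by (simp only: t_minus_sign(1) c x_t_Pos_Pos)
  also have "\<dots> = - (t Pos Neg s * (- 1) ^ s + t Neg Pos s * (- 1) ^ s)"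
    by (simp only: mult_minus_left distrib_right)
  finally show "x\<^sub>0 * t Neg Neg s - t Neg Neg s * x\<^sub>0 = - (t Pos Neg s + t Neg Pos s)"
    by (simp only: t_minus_sign(2,4)[symmetric] add.commute)
  have "x\<^sub>0 * t Neg Pos s + t Neg Pos s * x\<^sub>0 = (t Neg Neg s - t Pos Pos s) * (- 1) ^ s"
    by (simp only: t_minus_sign(2) c x_t_Pos_Neg)
  thus "x\<^sub>0 * t Neg Pos s + t Neg Pos s * x\<^sub>0 = t Pos Pos s - t Neg Neg s"
    by (simp only: left_diff_distrib t_minus_sign(1,3)[symmetric])
qed

lemma y_t_Neg: "y\<^sub>0 * t Neg Neg s - t Neg Neg s * y\<^sub>0 = x\<^sub>0 * t Pos Neg s + t Neg Pos s * x\<^sub>0"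
  "y\<^sub>0 * t Neg Pos s - t Neg Pos s * y\<^sub>0 =
    - (t Neg Pos (Suc s) + t Neg Pos (Suc s)) - t Neg Neg s * x\<^sub>0 - x\<^sub>0 * t Pos Pos s"
proof -
  have cc: "z * (- 1) ^ s = (- 1) ^ s * z" for z :: yangian
    by (cases "even s") simp_all
  note c = t_minus_sign(5)[of "y\<^sub>0" _ s]
  have "y\<^sub>0 * t Neg Neg s - t Neg Neg s * y\<^sub>0 = (x\<^sub>0 * t Neg Pos s + t Pos Neg s * x\<^sub>0) * (- 1) ^ s"
    by (simp only: t_minus_sign(1) c y_t_Pos_Pos)
  also have "\<dots> = x\<^sub>0 * (t Neg Pos s * (- 1) ^ s) + (t Pos Neg s * (- 1) ^ s) * x\<^sub>0"
    by (simp only: distrib_right mult.assoc cc[of "x\<^sub>0"])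
  finally show "y\<^sub>0 * t Neg Neg s - t Neg Neg s * y\<^sub>0 = x\<^sub>0 * t Pos Neg s + t Neg Pos s * x\<^sub>0"
    by (simp only: t_minus_sign(2,4)[symmetric])
  have "y\<^sub>0 * t Neg Pos s - t Neg Pos s * y\<^sub>0 =
     (t Pos Neg (Suc s) + t Pos Neg (Suc s) - t Pos Pos s * x\<^sub>0 - x\<^sub>0 * t Neg Neg s) * (- 1) ^ s"
    by (simp only: t_minus_sign(2) c y_t_Pos_Neg)
  also have "\<dots> = t Pos Neg (Suc s) * (- 1) ^ s + t Pos Neg (Suc s) * (- 1) ^ s
     - (t Pos Pos s * (- 1) ^ s) * x\<^sub>0 - x\<^sub>0 * (t Neg Neg s * (- 1) ^ s)"
    by (simp only: distrib_right left_diff_distrib mult.assoc cc[of "x\<^sub>0"])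
  also have "t Pos Neg (Suc s) * (- 1) ^ s = - t Neg Pos (Suc s)"
    by (simp add: t_Neg)
  finally show "y\<^sub>0 * t Neg Pos s - t Neg Pos s * y\<^sub>0 =
    - (t Neg Pos (Suc s) + t Neg Pos (Suc s)) - t Neg Neg s * x\<^sub>0 - x\<^sub>0 * t Pos Pos s"
    by (simp only: t_minus_sign(1,3)[symmetric]) simp
qed

section \<open>The inverse matrix\<close>

lemma ycomp_t: "ycomp p (t i j r) = (if p = bar i + bar j then t i j r else 0)"
  using homog_fcomp[OF homog_gfree[of i j r], of p]
  by (simp add: ycomp.abs_eq t.abs_eq zero_yangian.abs_eq split: if_splits)

lemma entry_sum: "entry (sum f A) i j = (\<Sum>a\<in>A. entry (f a) i j)"
  by (induction A rule: infinite_finite_induct) (simp_all add: zero_smat.rep_eq plus_smat.rep_eq)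

lemma T_T_inv_entries:
  "(\<Sum>j\<in>UNIV. ksign ((bar i + bar j) * (bar j + bar l)) * (t_series i j * tt_series j l)) =
    of_bool (i = l)"
proof (rule fps_ext)
  fix n
  have ksign_nth: "(ksign p * F) $ n = ksign p * F $ n" for p and F :: "yangian fps"
    by (simp add: ksign_mult)
  have entry: "entry (T $ m * z) i l = (\<Sum>j\<in>UNIV. ksign ((bar i + bar j) * (bar j + bar l)) * (t i j m * entry z j l))"
    for m z
  proof -
    have "(\<Sum>p\<in>{0, 1}. ksign (p * (bar j + bar l)) * (ycomp p (t i j m) * entry z j l)) =
       ksign ((bar i + bar j) * (bar j + bar l)) * (t i j m * entry z j l)" for j
      by (cases i; cases j; simp add: ycomp_t)
    thus ?thesis
      unfolding times_smat.rep_eq T_def by (simp add: smat_inverse)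
  qed
  have "(\<Sum>j\<in>UNIV. ksign ((bar i + bar j) * (bar j + bar l)) * (t_series i j * tt_series j l)) $ n =
    (\<Sum>j\<in>UNIV. \<Sum>m=0..n. ksign ((bar i + bar j) * (bar j + bar l)) *
        (t i j m * entry (T_inv $ (n - m)) j l))"
    unfolding fps_sum_nth ksign_nth unfolding fps_mult_nth sum_distrib_left
    by (simp add: t_series_def tt_series_def)
  also have "\<dots> = (\<Sum>m=0..n. entry (T $ m * T_inv $ (n - m)) i l)"
    unfolding entry by (rule sum.swap)
  also have "\<dots> = entry ((T * T_inv) $ n) i l"
    unfolding fps_mult_nth entry_sum ..
  also have "\<dots> = (of_bool (i = l) :: yangian fps) $ n"
    unfolding T_inverse by (cases "n = 0") (simp_all add: one_smat.rep_eq zero_smat.rep_eq)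
  finally show "(\<Sum>j\<in>UNIV. ksign ((bar i + bar j) * (bar j + bar l)) * (t_series i j * tt_series j l)) $ n
     = (of_bool (i = l) :: yangian fps) $ n" .
qed

lemma right_inverse_entries:
  "t_series Pos Pos * tt_series Pos Pos - t_series Pos Neg * tt_series Neg Pos = 1"
  "t_series Pos Pos * tt_series Pos Neg + t_series Pos Neg * tt_series Neg Neg = 0"
  "t_series Neg Neg * tt_series Neg Neg - t_series Neg Pos * tt_series Pos Neg = 1"
  "t_series Neg Neg * tt_series Neg Pos + t_series Neg Pos * tt_series Pos Pos = 0"
  using T_T_inv_entries[of Pos Pos] T_T_inv_entries[of Pos Neg] T_T_inv_entries[of Neg Neg]
    T_T_inv_entries[of Neg Pos]
  by (simp_all add: UNIV_idx ksign_def add.commute)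

lemma t_series_0: "t_series i j $ 0 = of_bool (i = j)"
  by (simp add: t_series_def t_0)

lemma T_kernel:
  assumes "t_series Pos Pos * f - t_series Pos Neg * g = 0"
    "t_series Neg Pos * f + t_series Neg Neg * g = 0"
  shows "f = 0 \<and> g = 0"
  by (rule fps_matrix_kernel[of "t_series Pos Pos" "- t_series Pos Neg" "t_series Neg Pos"
        "t_series Neg Neg"])
    (use assms in \<open>simp_all add: t_series_0\<close>)

text \<open>In the super tensor product, the entries of \<open>T\<^sup>-\<^sup>1 T\<close> involve the homogeneous components of the entries of
  \<open>T\<^sup>-\<^sup>1\<close>. These are avoided: the relations \<open>T T\<^sup>-\<^sup>1 = 1\<close>, after absorbing one sign, say that an ordinary matrix
  product is the identity. For ordinary matrices \<open>A B = 1\<close> implies \<open>A (B A - 1) = 0\<close>, whence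
  \<open>B A = 1\<close> by \<open>T_kernel\<close>, one column at a time.\<close>

lemma left_inverse_entries:
  "tt_series Pos Pos * t_series Pos Pos - tt_series Pos Neg * t_series Neg Pos = 1"
  "tt_series Pos Pos * t_series Pos Neg + tt_series Pos Neg * t_series Neg Neg = 0"
  "tt_series Neg Neg * t_series Neg Neg - tt_series Neg Pos * t_series Pos Neg = 1"
  "tt_series Neg Neg * t_series Neg Pos + tt_series Neg Pos * t_series Pos Pos = 0"
proof -
  let ?t = t_series and ?s = tt_series
  have zero: "?t Pos Pos * ?s Pos Pos - ?t Pos Neg * ?s Neg Pos - 1 = 0"
    "?t Neg Neg * ?s Neg Neg - ?t Neg Pos * ?s Pos Neg - 1 = 0"
    by (simp_all add: right_inverse_entries)
  have "?s Pos Pos * ?t Pos Pos - ?s Pos Neg * ?t Neg Pos - 1 = 0 \<and>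
      ?s Neg Pos * ?t Pos Pos + ?s Neg Neg * ?t Neg Pos = 0"
  proof (rule T_kernel)
    have "?t Pos Pos * (?s Pos Pos * ?t Pos Pos - ?s Pos Neg * ?t Neg Pos - 1)
       - ?t Pos Neg * (?s Neg Pos * ?t Pos Pos + ?s Neg Neg * ?t Neg Pos) = 
       (?t Pos Pos * ?s Pos Pos - ?t Pos Neg * ?s Neg Pos - 1) * ?t Pos Pos
       - (?t Pos Pos * ?s Pos Neg + ?t Pos Neg * ?s Neg Neg) * ?t Neg Pos"
      by (simp add: algebra_simps)
    thus "?t Pos Pos * (?s Pos Pos * ?t Pos Pos - ?s Pos Neg * ?t Neg Pos - 1)
       - ?t Pos Neg * (?s Neg Pos * ?t Pos Pos + ?s Neg Neg * ?t Neg Pos) = 0"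
      by (simp only: right_inverse_entries zero) simp
    have "?t Neg Pos * (?s Pos Pos * ?t Pos Pos - ?s Pos Neg * ?t Neg Pos - 1)
       + ?t Neg Neg * (?s Neg Pos * ?t Pos Pos + ?s Neg Neg * ?t Neg Pos) = 
       (?t Neg Neg * ?s Neg Pos + ?t Neg Pos * ?s Pos Pos) * ?t Pos Pos
       + (?t Neg Neg * ?s Neg Neg - ?t Neg Pos * ?s Pos Neg - 1) * ?t Neg Pos"
      by (simp add: algebra_simps)
    thus "?t Neg Pos * (?s Pos Pos * ?t Pos Pos - ?s Pos Neg * ?t Neg Pos - 1)
       + ?t Neg Neg * (?s Neg Pos * ?t Pos Pos + ?s Neg Neg * ?t Neg Pos) = 0"
      by (simp only: right_inverse_entries zero) simp
  qed
  moreover have "- ?s Pos Pos * ?t Pos Neg - ?s Pos Neg * ?t Neg Neg = 0 \<and>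
      ?s Neg Neg * ?t Neg Neg - ?s Neg Pos * ?t Pos Neg - 1 = 0"
  proof (rule T_kernel)
    have "?t Pos Pos * (- ?s Pos Pos * ?t Pos Neg - ?s Pos Neg * ?t Neg Neg)
       - ?t Pos Neg * (?s Neg Neg * ?t Neg Neg - ?s Neg Pos * ?t Pos Neg - 1) = 
       - (?t Pos Pos * ?s Pos Pos - ?t Pos Neg * ?s Neg Pos - 1) * ?t Pos Neg
       - (?t Pos Pos * ?s Pos Neg + ?t Pos Neg * ?s Neg Neg) * ?t Neg Neg"
      by (simp add: algebra_simps)
    thus "?t Pos Pos * (- ?s Pos Pos * ?t Pos Neg - ?s Pos Neg * ?t Neg Neg)
       - ?t Pos Neg * (?s Neg Neg * ?t Neg Neg - ?s Neg Pos * ?t Pos Neg - 1) = 0"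
      by (simp only: right_inverse_entries zero) simp
    have "?t Neg Pos * (- ?s Pos Pos * ?t Pos Neg - ?s Pos Neg * ?t Neg Neg)
       + ?t Neg Neg * (?s Neg Neg * ?t Neg Neg - ?s Neg Pos * ?t Pos Neg - 1) = 
       - (?t Neg Neg * ?s Neg Pos + ?t Neg Pos * ?s Pos Pos) * ?t Pos Neg
       + (?t Neg Neg * ?s Neg Neg - ?t Neg Pos * ?s Pos Neg - 1) * ?t Neg Neg"
      by (simp add: algebra_simps)
    thus "?t Neg Pos * (- ?s Pos Pos * ?t Pos Neg - ?s Pos Neg * ?t Neg Neg)
       + ?t Neg Neg * (?s Neg Neg * ?t Neg Neg - ?s Neg Pos * ?t Pos Neg - 1) = 0"
      by (simp only: right_inverse_entries zero) simp
  qed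
  ultimately show
    "?s Pos Pos * ?t Pos Pos - ?s Pos Neg * ?t Neg Pos = 1"
    "?s Pos Pos * ?t Pos Neg + ?s Pos Neg * ?t Neg Neg = 0"
    "?s Neg Neg * ?t Neg Neg - ?s Neg Pos * ?t Pos Neg = 1"
    "?s Neg Neg * ?t Neg Pos + ?s Neg Pos * ?t Pos Pos = 0"
    using neg_equal_0_iff_equal[of "?s Pos Pos * ?t Pos Neg + ?s Pos Neg * ?t Neg Neg"]
    by (simp_all add: add.commute)
qed

lemma subst_neg_mult: "subst_neg (f * g) = subst_neg f * subst_neg g"
proof (rule fps_ext)
  fix n
  show "subst_neg (f * g) $ n = (subst_neg f * subst_neg g) $ n"
    unfolding subst_neg_nth fps_mult_nth sum_distrib_right
  proof (intro sum.cong refl)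
    fix i assume "i \<in> {0..n}"
    thus "f $ i * g $ (n - i) * (- 1) ^ n = f $ i * (- 1) ^ i * (g $ (n - i) * (- 1) ^ (n - i))"
      by (cases "even i"; cases "even n") auto
  qed
qed

lemma subst_neg_simps: "subst_neg (f - g) = subst_neg f - subst_neg g"
   "subst_neg (f + g) = subst_neg f + subst_neg g" "subst_neg 1 = 1" "subst_neg 0 = 0"
  by (auto simp: fps_eq_iff subst_neg_nth algebra_simps)

text \<open>Replacing both indices by their negatives turns \<open>T(u)\<close> into \<open>T(-u)\<close>, so it must do the same to the inverse. Thus the
  factor in \<open>C\<close> that is evaluated at \<open>-u\<close> is itself an entry of \<open>T(u)\<^sup>-\<^sup>1\<close>.\<close>

lemma tt_series_minus:
  assumes "\<And>i j. subst_neg (t_series i j) = t_series (- i) (- j)"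
  shows "subst_neg (tt_series Pos Pos) = tt_series Neg Neg"
    "subst_neg (tt_series Neg Pos) = tt_series Pos Neg"
proof -
  let ?t = t_series and ?s = tt_series
  have 1: "?t Neg Neg * subst_neg (?s Pos Pos) - ?t Neg Pos * subst_neg (?s Neg Pos) = 1"
    "?t Pos Pos * subst_neg (?s Neg Pos) + ?t Pos Neg * subst_neg (?s Pos Pos) = 0"
    using right_inverse_entries(1,4)[THEN arg_cong, of subst_neg]
    by (simp_all only: subst_neg_simps subst_neg_mult assms uminus_idx_simps)
  have "?s Pos Neg - subst_neg (?s Neg Pos) = 0 \<and> subst_neg (?s Pos Pos) - ?s Neg Neg = 0"
  proof (rule T_kernel)
    have "?t Pos Pos * (?s Pos Neg - subst_neg (?s Neg Pos)) - ?t Pos Neg * (subst_neg (?s Pos Pos) - ?s Neg Neg)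
      = (?t Pos Pos * ?s Pos Neg + ?t Pos Neg * ?s Neg Neg)
        - (?t Pos Pos * subst_neg (?s Neg Pos) + ?t Pos Neg * subst_neg (?s Pos Pos))"
      by (simp add: algebra_simps)
    thus "?t Pos Pos * (?s Pos Neg - subst_neg (?s Neg Pos))
      - ?t Pos Neg * (subst_neg (?s Pos Pos) - ?s Neg Neg) = 0"
      by (simp only: right_inverse_entries 1) simp
    have "?t Neg Pos * (?s Pos Neg - subst_neg (?s Neg Pos)) + ?t Neg Neg * (subst_neg (?s Pos Pos) - ?s Neg Neg)
      = (?t Neg Neg * subst_neg (?s Pos Pos) - ?t Neg Pos * subst_neg (?s Neg Pos))
        - (?t Neg Neg * ?s Neg Neg - ?t Neg Pos * ?s Pos Neg)"
      by (simp add: algebra_simps)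
    thus "?t Neg Pos * (?s Pos Neg - subst_neg (?s Neg Pos))
      + ?t Neg Neg * (subst_neg (?s Pos Pos) - ?s Neg Neg) = 0"
      by (simp only: right_inverse_entries 1) simp
  qed
  thus  "subst_neg (tt_series Pos Pos) = tt_series Neg Neg"
    "subst_neg (tt_series Neg Pos) = tt_series Pos Neg"
    by auto
qed

section \<open>The symmetries of C and D\<close>

abbreviation t_fls :: "idx \<Rightarrow> idx \<Rightarrow> yangian fls" where "t_fls i j \<equiv> fps_to_fls (t_series i j)"

abbreviation tt_fls :: "idx \<Rightarrow> idx \<Rightarrow> yangian fls" where "tt_fls i j \<equiv> fps_to_fls (tt_series i j)"

lemma X_inv_nth: "(fls_X_inv * F) $$ n = F $$ (n + 1)" "(F * fls_X_inv) $$ n = F $$ (n + 1)"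
  for F :: "yangian fls"
  by (simp_all add: fls_X_inv_times_conv_shift)

abbreviation two_u :: "yangian fls" where "two_u \<equiv> fls_X_inv + fls_X_inv"

lemma two_u_nth: "(two_u * F) $$ n = F $$ (n + 1) + F $$ (n + 1)"
  by (simp add: distrib_right X_inv_nth)

lemma two_u_commute: "z * two_u = two_u * z"
  by (rule fls_eqI) (simp add: distrib_right distrib_left X_inv_nth)

interpretation T: T_system "t_fls Pos Pos" "t_fls Neg Neg" "t_fls Pos Neg" "t_fls Neg Pos"
    "tt_fls Pos Pos" "tt_fls Neg Neg" "tt_fls Pos Neg" "tt_fls Neg Pos" "fls_const x\<^sub>0" "fls_const y\<^sub>0" two_u
proof
  note r = right_inverse_entries left_inverse_entries
  show "t_fls Pos Pos * tt_fls Pos Pos - t_fls Pos Neg * tt_fls Neg Pos = 1"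
    "t_fls Pos Pos * tt_fls Pos Neg + t_fls Pos Neg * tt_fls Neg Neg = 0"
    "t_fls Neg Neg * tt_fls Neg Neg - t_fls Neg Pos * tt_fls Pos Neg = 1"
    "t_fls Neg Neg * tt_fls Neg Pos + t_fls Neg Pos * tt_fls Pos Pos = 0"
    "tt_fls Pos Pos * t_fls Pos Pos - tt_fls Pos Neg * t_fls Neg Pos = 1"
    "tt_fls Pos Pos * t_fls Pos Neg + tt_fls Pos Neg * t_fls Neg Neg = 0"
    "tt_fls Neg Neg * t_fls Neg Neg - tt_fls Neg Pos * t_fls Pos Neg = 1"
    "tt_fls Neg Neg * t_fls Neg Pos + tt_fls Neg Pos * t_fls Pos Pos = 0"
    by (simp_all only: r fps_to_fls_plus[symmetric] fps_to_fls_minus[symmetric]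
        fls_times_fps_to_fls[symmetric] fps_one_to_fls fps_zero_to_fls)
  show "z * two_u = two_u * z" for z by (rule two_u_commute)
  have nth: "t_fls i j $$ n = 0" if "n < 0" for i j n
    using that by simp
  have series: "t_fls i j $$ int m = t i j m" "t_fls i j $$ (int m + 1) = t i j (Suc m)"
     "t_fls i j $$ (- 1 + 1) = t i j 0" for i j m
    by (simp_all add: t_series_def nat_add_distrib)
  note coeffs = fls_plus_nth fls_minus_nth fls_uminus_nth fls_mult_const_nth two_u_nth series
  note relations = x_t_Pos_Pos x_t_Pos_Neg y_t_Pos_Pos y_t_Pos_Neg x_t_Neg y_t_Neg
  show "fls_const x\<^sub>0 * t_fls Pos Pos - t_fls Pos Pos * fls_const x\<^sub>0 = - (t_fls Pos Neg + t_fls Neg Pos)"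
    "fls_const x\<^sub>0 * t_fls Pos Neg + t_fls Pos Neg * fls_const x\<^sub>0 = t_fls Neg Neg - t_fls Pos Pos"
    "fls_const x\<^sub>0 * t_fls Neg Neg - t_fls Neg Neg * fls_const x\<^sub>0 = - (t_fls Pos Neg + t_fls Neg Pos)"
    "fls_const x\<^sub>0 * t_fls Neg Pos + t_fls Neg Pos * fls_const x\<^sub>0 = t_fls Pos Pos - t_fls Neg Neg"
    "fls_const y\<^sub>0 * t_fls Pos Pos - t_fls Pos Pos * fls_const y\<^sub>0 = fls_const x\<^sub>0 * t_fls Neg Pos + t_fls Pos Neg * fls_const x\<^sub>0"
    "fls_const y\<^sub>0 * t_fls Neg Neg - t_fls Neg Neg * fls_const y\<^sub>0 = fls_const x\<^sub>0 * t_fls Pos Neg + t_fls Neg Pos * fls_const x\<^sub>0"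
    "fls_const y\<^sub>0 * t_fls Pos Neg - t_fls Pos Neg * fls_const y\<^sub>0 =
      two_u * t_fls Pos Neg - t_fls Pos Pos * fls_const x\<^sub>0 - fls_const x\<^sub>0 * t_fls Neg Neg"
    "fls_const y\<^sub>0 * t_fls Neg Pos - t_fls Neg Pos * fls_const y\<^sub>0 =
      - (two_u * t_fls Neg Pos) - t_fls Neg Neg * fls_const x\<^sub>0 - fls_const x\<^sub>0 * t_fls Pos Pos"
    by (rule fls_eqI_from_minus_1; (simp only: coeffs relations)?; simp add: t_0 nth; fail)+
qed

lemma crossed_eq_0: "T.crossed = 0" "T.crossed' = 0"
proof -
  have "T.crossed $$ n = 0 \<and> T.crossed' $$ n = 0"
    if "\<And>m. m < n \<Longrightarrow> T.crossed $$ m = 0 \<and> T.crossed' $$ m = 0" for n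
    using T.y_crossed[THEN arg_cong, of "\<lambda>F. F $$ (n - 1)"]
      T.y_crossed'[THEN arg_cong, of "\<lambda>F. F $$ (n - 1)"] that[of "n - 1"]
    by (simp add: two_u_nth del: fls_const_mult_const)
  from fls_pair_zeroI[OF this] show "T.crossed = 0" "T.crossed' = 0" by auto
qed

lemma T_entries_reduced: "T_system_reduced (t_fls Pos Pos) (t_fls Neg Neg) (t_fls Pos Neg) (t_fls Neg Pos)
    (tt_fls Pos Pos) (tt_fls Neg Neg) (tt_fls Pos Neg) (tt_fls Neg Pos) (fls_const x\<^sub>0) (fls_const y\<^sub>0) two_u"
proof (intro T_system_reduced.intro T_system_reduced_axioms.intro T.T_system_axioms)
  show "t_fls Pos Pos * tt_fls Neg Pos = - (t_fls Neg Pos * tt_fls Neg Neg)"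
    by (subst eq_neg_iff_add_eq_0, subst add.commute) (rule crossed_eq_0(1)[unfolded T.crossed_def])
  show "t_fls Neg Neg * tt_fls Pos Neg = - (t_fls Pos Neg * tt_fls Pos Pos)"
    by (subst eq_neg_iff_add_eq_0, subst add.commute) (rule crossed_eq_0(2)[unfolded T.crossed'_def])
qed

text \<open>The two series are the defect and its image under \<open>u \<mapsto> -u\<close>. Comparing coefficients in \<open>y_defect\<close>, where the
  factor \<open>k\<^sup>2\<close> shifts the index by two, expresses their \<open>n\<close>-th coefficients through those with index \<open>n - 1\<close> and
  \<open>n - 2\<close>.\<close>

lemma defect_eq_0: "t_fls Pos Pos * tt_fls Neg Neg - t_fls Neg Neg * tt_fls Pos Pos
    - two_u * (t_fls Pos Neg * tt_fls Pos Neg) - two_u * (t_fls Pos Neg * tt_fls Pos Neg) = 0"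
  and bar_defect_eq_0: "t_fls Neg Neg * tt_fls Pos Pos - t_fls Pos Pos * tt_fls Neg Neg
    + two_u * (t_fls Neg Pos * tt_fls Neg Pos) + two_u * (t_fls Neg Pos * tt_fls Neg Pos) = 0"
proof -
  define F where "F = t_fls Pos Pos * tt_fls Neg Neg - t_fls Neg Neg * tt_fls Pos Pos
    - two_u * (t_fls Pos Neg * tt_fls Pos Neg) - two_u * (t_fls Pos Neg * tt_fls Pos Neg)"
  define G where "G = t_fls Neg Neg * tt_fls Pos Pos - t_fls Pos Pos * tt_fls Neg Neg
    + two_u * (t_fls Neg Pos * tt_fls Neg Pos) + two_u * (t_fls Neg Pos * tt_fls Neg Pos)"
  let ?y = "fls_const y\<^sub>0"
  have F: "two_u * (?y * F - F * ?y) = F + G + two_u * (two_u * F) + two_u * (two_u * F)"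
    using T_system_reduced.y_defect[OF T_entries_reduced]
    unfolding T_system_reduced.defect_def[OF T_entries_reduced] F_def[symmetric] G_def[symmetric] .
  have F': "t_fls Pos Pos * tt_fls Neg Neg - t_fls Neg Neg * tt_fls Pos Pos
     + - two_u * (t_fls Pos Neg * tt_fls Pos Neg) + - two_u * (t_fls Pos Neg * tt_fls Pos Neg) = F"
   and G': "t_fls Neg Neg * tt_fls Pos Pos - t_fls Pos Pos * tt_fls Neg Neg
    - - two_u * (t_fls Neg Pos * tt_fls Neg Pos) - - two_u * (t_fls Neg Pos * tt_fls Neg Pos) = G"
    by (simp_all only: F_def G_def mult_minus_left add_uminus_conv_diff diff_minus_eq_add)
  note bar = T_system_reduced.bar_central[OF T_entries_reduced]
  have G: "- two_u * (?y * G - G * ?y) = G + F + - two_u * (- two_u * G) + - two_u * (- two_u * G)"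
    using T_system_reduced.y_defect[OF bar]
    unfolding T_system_reduced.defect_def[OF bar] F' G' .
  have step: "F $$ n = 0 \<and> G $$ n = 0"
    if IH: "\<And>m. m < n \<Longrightarrow> F $$ m = 0 \<and> G $$ m = 0" for n
  proof -
    have 0: "F $$ (n - 1) = 0" "G $$ (n - 1) = 0" "F $$ (n - 2) = 0" "G $$ (n - 2) = 0"
      using IH[of "n - 1"] IH[of "n - 2"] by simp_all
    have 1: "(two_u * (two_u * H)) $$ (n - 2) = H $$ n + H $$ n + (H $$ n + H $$ n)" for H
      by (simp only: two_u_nth) simp
    have 2: "(two_u * (?y * H - H * ?y)) $$ (n - 2) =
       y\<^sub>0 * H $$ (n - 1) - H $$ (n - 1) * y\<^sub>0 + (y\<^sub>0 * H $$ (n - 1) - H $$ (n - 1) * y\<^sub>0)" for H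
      by (simp only: two_u_nth fls_minus_nth fls_mult_const_nth) simp
    note coeffs = mult_minus_left mult_minus_right fls_plus_nth fls_uminus_nth 0 1 2
    show ?thesis
      using F[THEN arg_cong, of "\<lambda>F. F $$ (n - 2)"] G[THEN arg_cong, of "\<lambda>F. F $$ (n - 2)"]
      unfolding coeffs by simp
  qed
  show "t_fls Pos Pos * tt_fls Neg Neg - t_fls Neg Neg * tt_fls Pos Pos
    - two_u * (t_fls Pos Neg * tt_fls Pos Neg) - two_u * (t_fls Pos Neg * tt_fls Pos Neg) = 0"
    "t_fls Neg Neg * tt_fls Pos Pos - t_fls Pos Pos * tt_fls Neg Neg
    + two_u * (t_fls Neg Pos * tt_fls Neg Pos) + two_u * (t_fls Neg Pos * tt_fls Neg Pos) = 0"
    using fls_pair_zeroI[OF step] unfolding F_def G_def by blast+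
qed

text \<open>The sum of the two vanishing series of the previous lemma is \<open>4 u (D(-u) - D(u))\<close>, and \<open>u\<close> may be cancelled.\<close>

lemma C_D_symmetry:
  "t_fls Neg Neg * tt_fls Pos Pos = t_fls Pos Pos * tt_fls Neg Neg - two_u * (t_fls Pos Neg * tt_fls Pos Neg)
      - two_u * (t_fls Pos Neg * tt_fls Pos Neg)"
  "t_fls Neg Pos * tt_fls Neg Pos = t_fls Pos Neg * tt_fls Pos Neg"
proof -
  have solve: "q = p - r - s" if "p - q - r - s = 0" for p q r s :: "yangian fls"
    using that by (simp add: algebra_simps)
  show 1: "t_fls Neg Neg * tt_fls Pos Pos = t_fls Pos Pos * tt_fls Neg Neg - two_u * (t_fls Pos Neg * tt_fls Pos Neg)
      - two_u * (t_fls Pos Neg * tt_fls Pos Neg)"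
    using defect_eq_0 by (rule solve)
  let ?G = "t_fls Neg Pos * tt_fls Neg Pos - t_fls Pos Neg * tt_fls Pos Neg"
  have "two_u * ?G + two_u * ?G = 0"
    using bar_defect_eq_0 unfolding 1 by (simp add: algebra_simps)
  hence "(two_u * ?G + two_u * ?G) $$ n = 0" for n
    by simp
  hence "?G $$ n = 0" for n
    unfolding fls_plus_nth two_u_nth by (metis add_self_eq_0_iff diff_add_cancel)
  thus "t_fls Neg Pos * tt_fls Neg Pos = t_fls Pos Neg * tt_fls Pos Neg"
    by (intro fls_eqI) simp
qed

lemma C_fls: "fps_to_fls C = t_fls Pos Pos * tt_fls Neg Neg"
  and D_fls: "fps_to_fls D = t_fls Pos Neg * tt_fls Pos Neg"
proof -
  have "subst_neg (t_series i j) = t_series (- i) (- j)" for i j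
    by (rule fps_ext) (simp add: subst_neg_nth t_series_def t_minus)
  from tt_series_minus(1)[OF this] show "fps_to_fls C = t_fls Pos Pos * tt_fls Neg Neg"
    by (simp add: C_def one_idx_def fls_times_fps_to_fls)
  show "fps_to_fls D = t_fls Pos Neg * tt_fls Pos Neg"
    by (simp add: D_def one_idx_def fls_times_fps_to_fls)
qed

lemma C_D_commute:
  "fls_const x\<^sub>0 * fps_to_fls C = fps_to_fls C * fls_const x\<^sub>0"
  "fls_const x\<^sub>0 * fps_to_fls D = fps_to_fls D * fls_const x\<^sub>0"
  "fls_const y\<^sub>0 * fps_to_fls C = fps_to_fls C * fls_const y\<^sub>0"
  "fls_const y\<^sub>0 * fps_to_fls D = fps_to_fls D * fls_const y\<^sub>0"
  unfolding C_fls D_fls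
  using T_system_reduced.x_C[OF T_entries_reduced] T_system_reduced.x_D[OF T_entries_reduced]
    T_system_reduced.y_C[OF T_entries_reduced] T_system_reduced.y_D_defect[OF T_entries_reduced]
  unfolding T_system_reduced.defect_def[OF T_entries_reduced] defect_eq_0 C_D_symmetry(2)
  by simp_all

lemma C_D_combination_commute:
  assumes "z * fps_to_fls C = fps_to_fls C * z" "z * fps_to_fls D = fps_to_fls D * z"
  shows "z * (fps_to_fls C + yfls g * fps_to_fls D) = (fps_to_fls C + yfls g * fps_to_fls D) * z"
proof -
  have "z * (fps_to_fls C + yfls g * fps_to_fls D) = z * fps_to_fls C + z * yfls g * fps_to_fls D"
    by (simp only: distrib_left mult.assoc)
  also have "\<dots> = fps_to_fls C * z + yfls g * (z * fps_to_fls D)"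
    by (simp only: assms(1) yfls_commute[of _ z, symmetric] mult.assoc)
  also have "\<dots> = (fps_to_fls C + yfls g * fps_to_fls D) * z"
    by (simp only: assms(2) distrib_right mult.assoc)
  finally show ?thesis .
qed

section \<open>The generating series of the odd elements\<close>

lemma superbracket_even: "superbracket y\<^sub>0 z = y\<^sub>0 * z - z * y\<^sub>0"
proof -
  have "superbracket y\<^sub>0 z = y\<^sub>0 * (ycomp 0 z + ycomp 1 z) - (ycomp 0 z + ycomp 1 z) * y\<^sub>0"
    by (simp add: superbracket_def ycomp_t ksign_def distrib_left distrib_right)
  thus ?thesis
    by (simp only: ycomp_decomp)
qed

lemma ycomp_scalar: "ycomp p (yscalar c * z) = yscalar c * ycomp p z"
proof -
  have "ycomp q (yscalar c) = (if q = 0 then yscalar c else 0)" for q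
    by transfer (simp add: fcomp_single yrel_def rel_ideal.zero)
  thus ?thesis
    by (simp add: ycomp_mult)
qed

lemma \<eta>_0: "\<eta> 0 = x\<^sub>0"
  by (simp add: \<eta>_def one_idx_def)

lemma \<eta>_Suc: "\<eta> (Suc i) = yscalar (- 1 / 2) * (y\<^sub>0 * \<eta> i - \<eta> i * y\<^sub>0)"
proof -
  let ?z = "(superbracket y\<^sub>0 ^^ i) x\<^sub>0" and ?c = "yscalar ((- 1 / 2) ^ i)"
  have "y\<^sub>0 * (?c * ?z) - ?c * ?z * y\<^sub>0 = ?c * (y\<^sub>0 * ?z - ?z * y\<^sub>0)"
    by (simp add: right_diff_distrib mult.assoc[symmetric] yscalar_commute[of _ "y\<^sub>0", symmetric])
  hence "yscalar (- 1 / 2) * (y\<^sub>0 * (?c * ?z) - ?c * ?z * y\<^sub>0) =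
      yscalar ((- 1 / 2) ^ Suc i) * (y\<^sub>0 * ?z - ?z * y\<^sub>0)"
    by (simp only: yscalar_mult mult.assoc power_Suc)
  thus ?thesis
    by (simp only: \<eta>_def one_idx_def uminus_idx_simps superbracket_even funpow.simps o_apply)
qed

lemma \<eta>_odd: "ycomp p (\<eta> i) = (if p = 1 then \<eta> i else 0)"
proof (induction i arbitrary: p)
  case 0
  show ?case by (simp add: \<eta>_0 ycomp_t)
next
  case (Suc i)
  have diff: "ycomp p (z - w) = ycomp p z - ycomp p w" for z w
    using ycomp_add[of p z "- w"] by (simp add: ycomp_uminus)
  show ?case
    unfolding \<eta>_Suc ycomp_scalar diff unfolding ycomp_mult by (cases p) (simp_all add: Suc ycomp_t)
qed

lemma superbracket_\<eta>: "superbracket (\<eta> i) (\<eta> j) = \<eta> i * \<eta> j + \<eta> j * \<eta> i"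
  by (simp add: superbracket_def \<eta>_odd ksign_def)

lemma Z_even_eq: "Z_even i = yscalar (1 / 2) * (x\<^sub>0 * \<eta> (2 * i) + \<eta> (2 * i) * x\<^sub>0)"
  by (simp only: Z_even_def superbracket_\<eta>[of 0, unfolded \<eta>_0] \<eta>_0)

text \<open>The series \<open>H\<close> together with the coefficients at even positions. They vanish by \<open>H_all_eq_H\<close> below, but
  the generating series of all \<open>\<eta>\<^sub>i\<close> satisfies a simple equation, and so it is this version of \<open>H\<close> that is
  determined first.\<close>

definition H_all :: "yangian fps" where
  "H_all = Abs_fps (\<lambda>n. if n = 0 then 0 else yscalar (1 / 2) * (x\<^sub>0 * \<eta> (n - 1) + \<eta> (n - 1) * x\<^sub>0))"

definition \<eta>_series :: "yangian fps" where
  "\<eta>_series = Abs_fps (\<lambda>n. if n = 0 then 0 else \<eta> (n - 1))"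

text \<open>This is \<open>(2 w + ad y) \<eta>(w) = 2 x\<close>, divided by \<open>w\<close>, with \<open>w\<^sup>-\<^sup>1\<close> as the variable of the power series.\<close>

lemma \<eta>_series_recursion:
  "\<eta>_series + \<eta>_series + fps_X * (fps_const y\<^sub>0 * \<eta>_series - \<eta>_series * fps_const y\<^sub>0) =
    fps_X * (fps_const x\<^sub>0 + fps_const x\<^sub>0)"
proof (rule fps_ext)
  have half: "\<eta> (Suc i) + \<eta> (Suc i) + (y\<^sub>0 * \<eta> i - \<eta> i * y\<^sub>0) = 0" for i
  proof -
    have "\<eta> (Suc i) + \<eta> (Suc i) = - (y\<^sub>0 * \<eta> i - \<eta> i * y\<^sub>0)"
      unfolding \<eta>_Suc distrib_right[symmetric] yscalar_add[symmetric]
      by (simp add: yscalar_uminus)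
    thus ?thesis by simp
  qed
  fix n
  consider "n = 0" | "n = 1" | i where "n = Suc (Suc i)"
    by (metis One_nat_def not0_implies_Suc)
  thus "(\<eta>_series + \<eta>_series + fps_X * (fps_const y\<^sub>0 * \<eta>_series - \<eta>_series * fps_const y\<^sub>0)) $ n =
    (fps_X * (fps_const x\<^sub>0 + fps_const x\<^sub>0)) $ n"
    by cases (use half in \<open>simp_all add: \<eta>_series_def \<eta>_0 fps_mult_right_const_nth fps_mult_left_const_nth fps_const_add del: fps_const_add\<close>)
qed

lemma H_all_double: "H_all + H_all = fps_const x\<^sub>0 * \<eta>_series + \<eta>_series * fps_const x\<^sub>0"
proof (rule fps_ext)
  fix n
  have "yscalar (1 / 2) * z + yscalar (1 / 2) * z = z" for z
    unfolding distrib_right[symmetric] yscalar_add[symmetric] by simp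
  thus "(H_all + H_all) $ n = (fps_const x\<^sub>0 * \<eta>_series + \<eta>_series * fps_const x\<^sub>0) $ n"
    by (simp add: H_all_def \<eta>_series_def)
qed

text \<open>Let \<open>c\<^sub>i\<^sub>j\<close> be the anticommutator of \<open>\<eta>\<^sub>i\<close> and \<open>\<eta>\<^sub>j\<close>. Up to a factor, \<open>[y, c\<^sub>i\<^sub>j]\<close> is \<open>c\<^sub>i\<^sub>+\<^sub>1\<^sub>,\<^sub>j + c\<^sub>i\<^sub>,\<^sub>j\<^sub>+\<^sub>1\<close>. If the elements
  \<open>c\<^sub>0\<^sub>j\<close> commute with \<open>y\<close>, then inductively \<open>c\<^sub>i\<^sub>j = (-1)\<^sup>i c\<^sub>0\<^sub>,\<^sub>i\<^sub>+\<^sub>j\<close>. For odd \<open>n\<close>, the symmetry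
  \<open>c\<^sub>0\<^sub>n = c\<^sub>n\<^sub>0 = - c\<^sub>0\<^sub>n\<close> gives zero.\<close>

lemma H_all_odd:
  assumes "\<And>n. y\<^sub>0 * H_all $ n = H_all $ n * y\<^sub>0"
  shows "H_all = H"
proof -
  define c where "c i j = \<eta> i * \<eta> j + \<eta> j * \<eta> i" for i j
  have half: "yscalar 2 * (yscalar (1 / 2) * z) = z" for z
    by (simp flip: mult.assoc yscalar_mult)
  have c0: "c 0 j = yscalar 2 * H_all $ (Suc j)" for j
    by (simp add: H_all_def c_def \<eta>_0 half)
  have comm0: "y\<^sub>0 * c 0 j = c 0 j * y\<^sub>0" for j
    unfolding c0 using assms[of "Suc j"] by (metis mult.assoc yscalar_commute)
  have shift: "c (Suc i) j + c i (Suc j) = yscalar (- 1 / 2) * (y\<^sub>0 * c i j - c i j * y\<^sub>0)" for i j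
  proof -
    have "c (Suc i) j + c i (Suc j) = yscalar (- 1 / 2) * ((y\<^sub>0 * \<eta> i - \<eta> i * y\<^sub>0) * \<eta> j
       + \<eta> j * (y\<^sub>0 * \<eta> i - \<eta> i * y\<^sub>0) + (\<eta> i * (y\<^sub>0 * \<eta> j - \<eta> j * y\<^sub>0)
       + (y\<^sub>0 * \<eta> j - \<eta> j * y\<^sub>0) * \<eta> i))"
      unfolding c_def \<eta>_Suc distrib_left
      by (simp only: mult.assoc[symmetric] yscalar_commute[of _ "\<eta> i", symmetric]
          yscalar_commute[of _ "\<eta> j", symmetric])
    also have "\<dots> = yscalar (- 1 / 2) * (y\<^sub>0 * c i j - c i j * y\<^sub>0)"
      by (rule arg_cong[of _ _ "(*) _"]) (simp add: c_def algebra_simps)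
    finally show ?thesis .
  qed
  have c: "c i j = (- 1) ^ i * c 0 (i + j)" for i j
  proof (induction i arbitrary: j)
    case (Suc i)
    have "y\<^sub>0 * c i j = c i j * y\<^sub>0"
      unfolding Suc[of j] by (cases "even i") (simp_all add: comm0)
    hence "c (Suc i) j = - c i (Suc j)"
      using shift[of i j] by (simp add: eq_neg_iff_add_eq_0)
    thus ?case
      using Suc[of "Suc j"] by simp
  qed simp
  have "c 0 n = 0" if "odd n" for n
  proof -
    have "c 0 n = c n 0"
      by (simp add: c_def add.commute)
    also have "\<dots> = - c 0 n"
      using c[of n 0] that by simp
    finally show ?thesis
      by (metis neg_eq_self_iff)
  qed
  hence "H_all $ n = 0" if "even n" for n
    using that c0[of "n - 1"] by (cases n) (auto simp: H_all_def)
  thus ?thesis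
    by (intro fps_ext)
      (auto simp: H_def Z_even_eq H_all_def elim!: oddE)
qed

section \<open>Substitution\<close>

definition recip :: "complex fls \<Rightarrow> yangian fps" where
  "recip w = fls_regpart (yfls (inverse w))"

lemma subst_u_recip: "subst_u f w = f oo recip w"
  by (simp add: subst_u_def recip_def)

lemma recip:
  assumes "fls_subdegree w = - 1"
  shows "fps_to_fls (recip w) = yfls (inverse w)" "recip w $ 0 = 0" "c * recip w $ m = recip w $ m * c"
    "recip w $ 1 = yscalar (inverse (w $$ (- 1)))"
proof -
  have "fls_subdegree (inverse w) = 1"
    using assms by (simp add: fls_inverse_subdegree)
  thus "fps_to_fls (recip w) = yfls (inverse w)" "recip w $ 0 = 0"
    by (simp_all add: recip_def subdegree_yfls)
  show "c * recip w $ m = recip w $ m * c"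
    by (simp add: recip_def yscalar_commute)
  show "recip w $ 1 = yscalar (inverse (w $$ (- 1)))"
    using assms fls_inverse_def'[of w] by (simp add: recip_def fls_lr_inverse_base)
qed

lemma compose_recip_mult:
  assumes "fls_subdegree w = - 1"
  shows "(f * g) oo recip w = (f oo recip w) * (g oo recip w)"
  using recip[OF assms] by (intro compose_mult)

text \<open>The identity \<open>(1 + M) H(w) = 1 - M\<close> of the introduction. The choice of sign of the square root \<open>d\<close>, and hence
  of \<open>w\<close>, is left open. The factor \<open>N = 1 + d + 2 u\<close> may be cancelled because
  \<open>N (1 + d - 2 u) = 2 (d + 1) = 4 w\<close> is not zero.\<close>

lemma H_all_identity:
  fixes d w :: "complex fls"
  assumes d: "d * d = 1 + 4 * fls_X_inv ^ 2" and w: "2 * w = d + 1" "fls_subdegree w = - 1"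
  defines "M \<equiv> fps_to_fls C + yfls (d - 2 * fls_X_inv) * fps_to_fls D"
  shows "(1 + M) * fps_to_fls (H_all oo recip w) = 1 - M"
proof -
  let ?x = "fls_const x\<^sub>0" and ?y = "fls_const y\<^sub>0" and ?h = "recip w"
  have w0: "w \<noteq> 0"
    using w(2) by auto
  have dc: "z * yfls d = yfls d * z" for z
    by (simp add: yfls_commute)
  have dd: "yfls d * yfls d = 1 + two_u * two_u"
  proof -
    have "d * d = 1 + (fls_X_inv + fls_X_inv) * (fls_X_inv + fls_X_inv)"
      unfolding d by algebra
    from arg_cong[OF this, of yfls] show ?thesis
      by (simp only: yfls_mult yfls_add yfls_1 yfls_X_inv)
  qed
  have k: "yfls (2 * fls_X_inv) = two_u"
    by (simp only: mult_2 yfls_add yfls_X_inv)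
  have M: "M = t_fls Pos Pos * tt_fls Neg Neg + (yfls d - two_u) * (t_fls Pos Neg * tt_fls Pos Neg)"
    unfolding M_def C_fls D_fls yfls_diff k ..
  define \<zeta> where "\<zeta> = t_fls Pos Neg * tt_fls Pos Pos + (yfls d + two_u) * (t_fls Neg Pos * tt_fls Neg Neg)"
  note cen = T_entries_reduced
  have y\<zeta>: "(yfls d + 1) * \<zeta> + (?y * \<zeta> - \<zeta> * ?y) = - ((1 + yfls d + two_u) * (1 + M) * ?x)"
   and x\<zeta>: "?x * \<zeta> + \<zeta> * ?x = (1 + yfls d + two_u) * (M - 1)"
    unfolding \<zeta>_def M
    by (rule inhomogeneous_equation_\<zeta>[OF two_u_commute dc dd]; 
        (rule T_system_reduced.y_p[OF cen, unfolded C_D_symmetry] T_system_reduced.y_q[OF cen, unfolded C_D_symmetry]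
         T_system_reduced.x_p[OF cen, unfolded C_D_symmetry] T_system_reduced.x_q[OF cen, unfolded C_D_symmetry]))+
  \<comment> \<open>The series \<open>\<eta>(w)\<close>; its equation is \<open>\<eta>_series_recursion\<close> multiplied by \<open>w\<close>.\<close>
  define \<theta> where "\<theta> = fps_to_fls (\<eta>_series oo ?h)"
  have X: "fps_X oo ?h = ?h"
  proof (rule fps_ext)
    fix n
    show "(fps_X oo ?h) $ n = ?h $ n"
    proof (cases "n = 0")
      case False
      have "(fps_X oo ?h) $ n = (\<Sum>i\<in>{1}. fps_X $ i * (?h ^ i) $ n)"
        unfolding fps_compose_nth using False by (intro sum.mono_neutral_right) (auto simp: fps_X_def)
      thus ?thesis by simp
    qed (simp add: recip(2)[OF w(2)])
  qed
  have "yfls (inverse w) * (yfls w * (\<theta> + \<theta>) + (?y * \<theta> - \<theta> * ?y)) = yfls (inverse w) * (?x + ?x)"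
  proof -
    have "fps_to_fls ((\<eta>_series + \<eta>_series + fps_X * (fps_const y\<^sub>0 * \<eta>_series - \<eta>_series * fps_const y\<^sub>0)) oo ?h) =
       fps_to_fls ((fps_X * (fps_const x\<^sub>0 + fps_const x\<^sub>0)) oo ?h)"
      unfolding \<eta>_series_recursion ..
    hence "\<theta> + \<theta> + yfls (inverse w) * (?y * \<theta> - \<theta> * ?y) = yfls (inverse w) * (?x + ?x)"
      by (simp only: fps_compose_add_distrib fps_compose_sub_distrib compose_recip_mult[OF w(2)] fps_const_compose_any X
          fps_to_fls_plus fps_to_fls_minus fls_times_fps_to_fls recip(1)[OF w(2)] fps_const_to_fls \<theta>_def)
    moreover have "yfls (inverse w) * yfls w = 1"
      using w0 by (simp flip: yfls_mult)
    hence "yfls (inverse w) * (yfls w * z) = z" for z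
      by (simp add: mult.assoc[symmetric])
    ultimately show ?thesis
      by (simp only: distrib_left[of "yfls (inverse w)" "yfls w * (\<theta> + \<theta>)"])
  qed
  moreover have "inverse w \<noteq> 0"
    using w0 by simp
  ultimately have "yfls w * (\<theta> + \<theta>) + (?y * \<theta> - \<theta> * ?y) = ?x + ?x"
    by (rule yfls_cancel[rotated])
  moreover have "yfls w * (\<theta> + \<theta>) = (yfls d + 1) * \<theta>"
  proof -
    have "yfls w + yfls w = yfls d + 1"
      using arg_cong[OF w(1), of yfls] by (simp only: mult_2 yfls_add yfls_1)
    thus ?thesis
      by (simp only: distrib_left distrib_right[symmetric])
  qed
  ultimately have \<theta>: "(yfls d + 1) * \<theta> + (?y * \<theta> - \<theta> * ?y) = ?x + ?x"
    by simp
  define N where "N = 1 + d + 2 * fls_X_inv"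
  have N: "yfls N = 1 + yfls d + two_u"
    by (simp only: N_def yfls_add yfls_1 k)
  have N0: "N \<noteq> 0"
  proof
    assume "N = 0"
    moreover have "N * (1 + d - 2 * fls_X_inv) = 2 * (d + 1)"
      using d by (simp add: N_def algebra_simps power2_eq_square)
    ultimately have "2 * (2 * w) = 0"
      by (simp only: w(1) mult_zero_left)
    thus False
      using w0 by simp
  qed
  have MC: "?x * M = M * ?x" "?y * M = M * ?y"
    unfolding M_def by (intro C_D_combination_commute C_D_commute)+
  have N2: "2 * N \<noteq> 0"
    using N0 by simp
  \<comment> \<open>By uniqueness of the resolvent \<open>N (1 + M) \<eta>(w) = - 2 \<zeta>\<close>.\<close>
  define \<Delta> where "\<Delta> = yfls N * (1 + M) * \<theta> + \<zeta> + \<zeta>"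
  have \<Delta>: "(yfls d + 1) * \<Delta> + (?y * \<Delta> - \<Delta> * ?y) = 0"
     "?x * \<Delta> + \<Delta> * ?x = yfls N * (1 + M) * (?x * \<theta> + \<theta> * ?x) + (?x * \<zeta> + \<zeta> * ?x) + (?x * \<zeta> + \<zeta> * ?x)"
    unfolding \<Delta>_def
    by (rule homogeneous_equation_\<Delta>[OF yfls_commute[symmetric] dc MC y\<zeta>[folded N] \<theta>])+
  have "\<Delta> = 0"
  proof (rule commutator_contraction)
    define v where "v = 2 * w"
    have v: "v \<noteq> 0" "fls_subdegree v = - 1"
      using w0 w(2) by (simp_all add: v_def flip: fls_const_numeral)
    show "fls_subdegree (yfls (- inverse v)) \<ge> 1"
      using fls_inverse_subdegree[of v] v(2) by (simp add: subdegree_yfls)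
    show "fls_subdegree ?y \<ge> 0" 
      by simp
    have "inverse v * v = 1"
      using v(1) by simp
    hence "\<Delta> = yfls (inverse v) * (yfls v * \<Delta>)"
      by (simp only: mult.assoc[symmetric] yfls_mult[symmetric] yfls_1 mult_1_left)
    also have "yfls v * \<Delta> = - (?y * \<Delta> - \<Delta> * ?y)"
      using \<Delta>(1) unfolding v_def w(1) yfls_add yfls_1 by (simp only: eq_neg_iff_add_eq_0)
    finally show "\<Delta> = yfls (- inverse v) * (?y * \<Delta> - \<Delta> * ?y)"
      by (simp only: yfls_uminus mult_minus_left mult_minus_right)
  qed
  \<comment> \<open>What is left is the supercommutator of this equation with \<open>x\<close>.\<close>
  define Hh where "Hh = fps_to_fls (H_all oo ?h)"
  have "fps_to_fls ((H_all + H_all) oo ?h) = ?x * \<theta> + \<theta> * ?x"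
    unfolding H_all_double
    by (simp only: fps_compose_add_distrib compose_recip_mult[OF w(2)] fps_const_compose_any
          fps_to_fls_plus fls_times_fps_to_fls fps_const_to_fls \<theta>_def)
  hence x\<theta>: "?x * \<theta> + \<theta> * ?x = Hh + Hh"
    by (simp only: fps_compose_add_distrib fps_to_fls_plus Hh_def)
  have regroup: "n * (1 + m) * (z + z) + n * (m - 1) + n * (m - 1) =
    n * ((1 + m) * z + (m - 1)) + n * ((1 + m) * z + (m - 1))" for n m z :: "yangian fls"
    by (simp add: algebra_simps)
  have "yfls N * ((1 + M) * Hh + (M - 1)) + yfls N * ((1 + M) * Hh + (M - 1)) = 0"
    using \<Delta>(2) unfolding \<open>\<Delta> = 0\<close> x\<theta> x\<zeta> N[symmetric] regroup by simp
  hence "yfls (2 * N) * ((1 + M) * Hh + (M - 1)) = yfls (2 * N) * 0"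
    by (simp only: mult_2 yfls_add distrib_right mult_zero_right)
  hence "(1 + M) * Hh + (M - 1) = 0"
    by (rule yfls_cancel[OF N2])
  thus ?thesis
    unfolding Hh_def by (simp add: eq_neg_iff_add_eq_0[symmetric])
qed

section \<open>The main identity\<close>

lemma \<delta>_square: "\<delta> * \<delta> = 1 + 4 * fls_X_inv ^ 2"
proof -
  let ?g = "fps_const (1 / 4) * fps_X ^ 2 :: complex fps"
  have "(fps_binomial (1 / 2) oo ?g) * (fps_binomial (1 / 2) oo ?g) = (1 + fps_X :: complex fps) oo ?g"
    by (simp flip: fps_compose_mult_distrib fps_binomial_add_mult add: fps_binomial_1)
  also have "\<dots> = 1 + ?g"
    by (simp add: fps_compose_add_distrib)
  finally have "fps_to_fls (fps_binomial (1 / 2) oo ?g) * fps_to_fls (fps_binomial (1 / 2) oo ?g) =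
     fps_to_fls (1 + ?g)"
    by (simp flip: fls_times_fps_to_fls)
  hence "\<delta> * \<delta> = 4 * fls_X_inv ^ 2 * fps_to_fls (1 + ?g)"
    by (simp add: \<delta>_def power2_eq_square)
  have X: "fls_X_inv * fls_X = (1 :: complex fls)"
    by (rule fls_eqI) (simp add: fls_X_inv_times_conv_shift)
  note \<open>\<delta> * \<delta> = _\<close>
  also have "fps_to_fls (1 + ?g) = 1 + fls_const (1 / 4) * fls_X ^ 2"
    by (simp add: fls_times_fps_to_fls fps_to_fls_power fps_const_to_fls)
  also have "4 * fls_X_inv ^ 2 * (1 + fls_const (1 / 4) * fls_X ^ 2 :: complex fls) =
      4 * fls_X_inv ^ 2 + (4 * fls_const (1 / 4)) * (fls_X_inv * fls_X) ^ 2"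
    by (simp only: distrib_left power_mult_distrib mult_1_right mult_1_left mult_ac)
  also have "(4 * fls_const (1 / 4) :: complex fls) = 1"
    by (simp flip: fls_const_numeral)
  finally show ?thesis
    by (simp only: X power_one mult_1_left add.commute)
qed

lemma \<delta>_nth: "\<delta> $$ (- 1) = 2" "n < - 1 \<Longrightarrow> \<delta> $$ n = 0"
proof -
  let ?B = "fps_to_fls (fps_binomial (1 / 2) oo fps_const (1 / 4) * fps_X ^ 2) :: complex fls"
  have "\<delta> = fls_X_inv * ?B + fls_X_inv * ?B"
    by (simp only: \<delta>_def mult_2 distrib_right)
  from arg_cong[OF this, of "\<lambda>F. F $$ n" for n]
  have nth: "\<delta> $$ n = ?B $$ (n + 1) + ?B $$ (n + 1)" for n
    by (simp only: fls_X_inv_times_conv_shift fls_shift_nth fls_plus_nth)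
  show "\<delta> $$ (- 1) = 2" "n < - 1 \<Longrightarrow> \<delta> $$ n = 0"
    unfolding nth by simp_all
qed

lemma \<rho>_eqs: "2 * (\<rho> + 1) = \<delta> + 1" "2 * (- \<rho>) = - \<delta> + 1"
  by (simp_all add: \<rho>_def field_simps)

lemma \<rho>_leading: "(\<rho> + 1) $$ (- 1) = 1"
  "fls_subdegree (\<rho> + 1) = - 1" "fls_subdegree \<rho> = - 1"
proof -
  have 1: "(\<rho> + 1) $$ n + (\<rho> + 1) $$ n = (\<delta> + 1) $$ n"
    and 2: "(- \<rho>) $$ n + (- \<rho>) $$ n = (- \<delta> + 1) $$ n" for n
    by (simp_all only: \<rho>_eqs[symmetric] mult_2 fls_plus_nth)
  show lead: "(\<rho> + 1) $$ (- 1) = 1"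
    using 1[of "- 1"] by (simp add: \<delta>_nth)
  have low: "(\<rho> + 1) $$ n = 0" "\<rho> $$ n = 0" if "n < - 1" for n
    using 1[of n] 2[of n] that by (simp_all add: \<delta>_nth)
  show "fls_subdegree (\<rho> + 1) = - 1"
    using lead low by (intro fls_subdegree_eqI) simp_all
  show "fls_subdegree \<rho> = - 1"
    using lead low by (intro fls_subdegree_eqI) simp_all
qed

text \<open>By \<open>H_all_odd\<close> it suffices that the coefficients of \<open>H_all\<close> commute with \<open>y\<close>. The identity \<open>(1 + M) (1 + K) = 2\<close>
  for \<open>K = H_all(\<rho> + 1)\<close> expresses \<open>K\<close> through \<open>M\<close>, which commutes with \<open>y\<close>; hence so does \<open>K\<close>. Substitution of
  \<open>\<rho> + 1\<close> is injective, so the same holds for \<open>H_all\<close>.\<close>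

lemma H_all_eq_H: "H_all = H"
proof (rule H_all_odd)
  let ?h = "recip (\<rho> + 1)" and ?y = "fls_const y\<^sub>0"
  define M where "M = fps_to_fls C + yfls (\<delta> - 2 * fls_X_inv) * fps_to_fls D"
  define K where "K = fps_to_fls (H_all oo ?h)"
  have eq: "(1 + M) * K = 1 - M"
    unfolding M_def K_def by (intro H_all_identity \<delta>_square \<rho>_eqs \<rho>_leading)
  have M: "?y * M = M * ?y"
    unfolding M_def by (intro C_D_combination_commute C_D_commute)
  have h1: "?h $ 1 = 1"
    by (simp only: recip(4)[OF \<rho>_leading(2)] \<rho>_leading(1)) simp
  \<comment> \<open>\<open>J\<close> is the inverse of \<open>1 + K\<close>, so that \<open>1 + M = 2 J\<close>.\<close>
  define J where "J = fps_to_fls (fps_right_inverse (1 + (H_all oo ?h)) 1)"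
  have "(1 + (H_all oo ?h)) * fps_right_inverse (1 + (H_all oo ?h)) 1 = 1"
    by (rule fps_right_inverse) (simp add: H_all_def)
  moreover have "fps_to_fls (1 + (H_all oo ?h)) = 1 + K"
    by (simp only: fps_to_fls_plus fps_one_to_fls K_def)
  ultimately have J: "(1 + K) * J = 1"
    unfolding J_def by (metis fls_times_fps_to_fls fps_one_to_fls)
  have "(1 + M) * (1 + K) = 1 + 1"
    using eq by (simp only: distrib_left mult_1_right) simp
  hence "(1 + M) * ((1 + K) * J) = (1 + 1) * J"
    by (simp only: mult.assoc[symmetric])
  hence M2: "1 + M = J + J"
    unfolding J by (simp only: distrib_right mult_1_left mult_1_right)
  have "(1 + M) * (?y * K - K * ?y) = ?y * ((1 + M) * K) - (1 + M) * K * ?y"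
    using M by (simp add: algebra_simps) (metis M mult.assoc)
  also have "\<dots> = 0"
    unfolding eq using M by (simp add: algebra_simps)
  finally have "(1 + K) * ((J + J) * (?y * K - K * ?y)) = 0"
    unfolding M2 by (simp only: mult_zero_right)
  moreover have "(1 + K) * ((J + J) * c) = (1 + K) * J * c + (1 + K) * J * c" for c
    by (simp add: algebra_simps)
  ultimately have "(1 + K) * J * (?y * K - K * ?y) + (1 + K) * J * (?y * K - K * ?y) = 0"
    by simp
  hence "(?y * K - K * ?y) + (?y * K - K * ?y) = 0"
    by (simp only: J mult_1_left)
  hence "(?y * K - K * ?y) $$ n + (?y * K - K * ?y) $$ n = 0" for n
    by (metis fls_plus_nth fls_zero_nth)
  hence "?y * K - K * ?y = 0"
    by (intro fls_eqI) (simp only: add_self_eq_0_iff fls_zero_nth)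
  moreover have "fps_to_fls ((fps_const y\<^sub>0 * H_all - H_all * fps_const y\<^sub>0) oo ?h) = ?y * K - K * ?y"
    by (simp only: fps_compose_sub_distrib compose_recip_mult[OF \<rho>_leading(2)] fps_const_compose_any
        fps_to_fls_minus fls_times_fps_to_fls fps_const_to_fls K_def)
  ultimately have "(fps_const y\<^sub>0 * H_all - H_all * fps_const y\<^sub>0) oo ?h = 0"
    by (simp only: fps_to_fls_eq_0_iff)
  hence "fps_const y\<^sub>0 * H_all - H_all * fps_const y\<^sub>0 = 0"
    by (rule compose_eq_0D[OF recip(2)[OF \<rho>_leading(2)] h1])
  hence "(fps_const y\<^sub>0 * H_all) $ n = (H_all * fps_const y\<^sub>0) $ n" for n
    by simp
  thus "y\<^sub>0 * H_all $ n = H_all $ n * y\<^sub>0" for n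
    by simp
qed

lemma M_times_1_plus_H:
  fixes d w :: "complex fls"
  assumes "d * d = 1 + 4 * fls_X_inv ^ 2" "2 * w = d + 1" "fls_subdegree w = - 1"
  shows "(fps_to_fls C + yfls (d - 2 * fls_X_inv) * fps_to_fls D) * fps_to_fls (1 + (H oo recip w)) =
    fps_to_fls (1 - (H oo recip w))"
proof -
  have "(1 + m) * z = 1 - m \<Longrightarrow> m * (1 + z) = 1 - z" for m z :: "yangian fls"
    by (simp add: distrib_left distrib_right eq_diff_eq add_ac)
  from this[OF H_all_identity[OF assms]] show ?thesis
    by (simp only: H_all_eq_H fps_to_fls_plus fps_to_fls_minus fps_one_to_fls)
qed

lemma Q_compose:
  assumes "fls_subdegree w = - 1"
  obtains R where "subst_u Q w = (1 + (H oo recip w)) * R" "(1 - (H oo recip w)) * R = 1"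
proof
  let ?R = "fps_right_inverse (1 - H) 1 oo recip w"
  have one: "1 oo recip w = 1"
    using fps_const_compose_any[of 1] by simp
  show "subst_u Q w = (1 + (H oo recip w)) * ?R"
    by (simp only: subst_u_recip Q_def compose_recip_mult[OF assms] fps_compose_add_distrib one)
  show "(1 - (H oo recip w)) * ?R = 1"
    by (simp only: H_inverse(1) one compose_recip_mult[OF assms, symmetric]
        fps_compose_sub_distrib[of 1 H "recip w", unfolded one, symmetric])
qed

lemma H_compose_uminus: "H oo (- h) = - (H oo h)"
proof (rule fps_ext)
  fix n
  have "(- h) ^ i = - (h ^ i)" if "odd i" for i
    using that by simp
  thus "(H oo (- h)) $ n = (- (H oo h)) $ n"
    unfolding fps_compose_nth fps_neg_nth sum_negf[symmetric]
    by (intro sum.cong refl) (auto simp: H_def)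
qed

text \<open>With the notation of the introduction, \<open>M_times_1_plus_H\<close> reads \<open>M (1 + H(w)) = 1 - H(w)\<close>. For \<open>w = \<rho> + 1\<close> this makes
  \<open>M\<close> a left inverse of \<open>Q(w)\<close>, which must coincide with the right inverse. For \<open>w = - \<rho>\<close> the oddness of \<open>H\<close>
  turns it into \<open>M (1 - H(\<rho>)) = 1 + H(\<rho>)\<close>, so \<open>M\<close> equals \<open>Q(\<rho>)\<close>.\<close>

theorem theorem3p4:
  shows "fps_to_fls (subst_u Q \<rho>) =
           fps_to_fls C - yfls (\<delta> + 2 * fls_X_inv) * fps_to_fls D
       \<and> fps_to_fls (fps_right_inverse (subst_u Q (\<rho> + 1)) 1) =
           fps_to_fls C + yfls (\<delta> - 2 * fls_X_inv) * fps_to_fls D"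
proof
  define M where "M = fps_to_fls C - yfls (\<delta> + 2 * fls_X_inv) * fps_to_fls D"
  let ?K = "H oo recip \<rho>"
  obtain R where R: "subst_u Q \<rho> = (1 + ?K) * R" "(1 - ?K) * R = 1"
    using Q_compose[OF \<rho>_leading(3)] .
  have "M = fps_to_fls C + yfls (- \<delta> - 2 * fls_X_inv) * fps_to_fls D"
  proof -
    have "- \<delta> - 2 * fls_X_inv = - (\<delta> + 2 * fls_X_inv)"
      by simp
    thus ?thesis
      by (simp only: M_def yfls_uminus mult_minus_left add_uminus_conv_diff)
  qed
  moreover have "H oo recip (- \<rho>) = - ?K"
  proof -
    have "recip (- \<rho>) = - recip \<rho>"
      by (simp add: recip_def yfls_uminus fps_eq_iff)
    thus ?thesis
      by (simp only: H_compose_uminus)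
  qed
  moreover have "(- \<delta>) * (- \<delta>) = 1 + 4 * fls_X_inv ^ 2" "fls_subdegree (- \<rho>) = - 1"
    by (simp_all only: minus_mult_minus \<delta>_square fls_uminus_subdegree \<rho>_leading)
  ultimately have "M * fps_to_fls (1 - ?K) = fps_to_fls (1 + ?K)"
    using M_times_1_plus_H[of "- \<delta>" "- \<rho>", OF _ \<rho>_eqs(2)]
    by (simp only: add_uminus_conv_diff diff_minus_eq_add)
  hence "fps_to_fls (1 + ?K) * fps_to_fls R = M * (fps_to_fls (1 - ?K) * fps_to_fls R)"
    by (simp only: mult.assoc[symmetric])
  thus "fps_to_fls (subst_u Q \<rho>) = fps_to_fls C - yfls (\<delta> + 2 * fls_X_inv) * fps_to_fls D"
    by (simp only: R fls_times_fps_to_fls[symmetric] fps_one_to_fls mult_1_right M_def)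
next
  define M where "M = fps_to_fls C + yfls (\<delta> - 2 * fls_X_inv) * fps_to_fls D"
  let ?K = "H oo recip (\<rho> + 1)" and ?Q = "subst_u Q (\<rho> + 1)"
  obtain R where R: "?Q = (1 + ?K) * R" "(1 - ?K) * R = 1"
    using Q_compose[OF \<rho>_leading(2)] .
  have "M * fps_to_fls (1 + ?K) = fps_to_fls (1 - ?K)"
    unfolding M_def by (intro M_times_1_plus_H \<delta>_square \<rho>_eqs \<rho>_leading)
  hence "M * (fps_to_fls (1 + ?K) * fps_to_fls R) = fps_to_fls (1 - ?K) * fps_to_fls R"
    by (simp only: mult.assoc[symmetric])
  hence MQ: "M * fps_to_fls ?Q = 1"
    by (simp only: R fls_times_fps_to_fls[symmetric] fps_one_to_fls)
  have "?Q * fps_right_inverse ?Q 1 = 1"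
    by (rule fps_right_inverse) (simp add: subst_u_recip Q_def H_def)
  hence "M * fps_to_fls ?Q * fps_to_fls (fps_right_inverse ?Q 1) = M"
    by (simp only: mult.assoc fls_times_fps_to_fls[symmetric] fps_one_to_fls mult_1_right)
  thus "fps_to_fls (fps_right_inverse ?Q 1) = fps_to_fls C + yfls (\<delta> - 2 * fls_X_inv) * fps_to_fls D"
    unfolding MQ unfolding mult_1_left M_def .
qed

end
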